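(* Let $1<p<q<\infty$, let $\beta\in\mathbb{R}$, and define the discrete weight $\omega$ on $\mathbb{Z}$ by $\omega(k):=|k|^\beta$ for $k\ne0$ and $\omega(0):=1$. Then the discrete Hardy–Littlewood maximal operator $\mathcal{M}$ is bounded on $l^p_{q\,(\omega)}$ if and only if $-1<\beta<q-1$.
   Context: Let $\mathbb{N}=\{0,1,2,\dots\}$ and, for $m\in\mathbb{Z}$, $N\in\mathbb{N}$, $S_{m,N}:=\{k\in\mathbb{Z}:|k-m|\le N\}$, so $|S_{m,N}|=2N+1$. For a finite set $S\subset\mathbb{Z}$, $\omega(S):=\sum_{k\in S}\omega(k)$. The discrete weighted Morrey space $l^p_{q\,(\omega)}$ is the set of real sequences $x=\{x(k)\}_{k\in\mathbb{Z}}$ with $$\|x\|_{l^p_{q\,(\omega)}}:=\sup_{m\in\mathbb{Z},N\in\mathbb{N}}\omega(S_{m,N})^{\frac1q-\frac1p}\Big(\sum_{k\in S_{m,N}}|x(k)|^p\omega(k)\Big)^{1/p}<\infty.$$ The discrete Hardy–Littlewood maximal operator is $\mathcal{M}x(m):=\sup_{N\in\mathbb{N}}\frac1{|S_{m,N}|}\sum_{k\in S_{m,N}}|x(k)|$, $m\in\mathbb{Z}$. "$\mathcal{M}$ is bounded on $l^p_{q\,(\omega)}$" means there is a constant $C>0$ such that for all $x\in l^p_{q\,(\omega)}$, $\mathcal{M}x\in l^p_{q\,(\omega)}$ and $\|\mathcal{M}x\|_{l^p_{q\,(\omega)}}\le C\|x\|_{l^p_{q\,(\omega)}}$. *)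

theory Defs
  imports Complex_Main "HOL-Library.Extended_Real"
begin

definition sym_interval :: "int \<Rightarrow> nat \<Rightarrow> int set" where
  "sym_interval m N = {k. \<bar>k - m\<bar> \<le> int N}"

text \<open>The supremum defining the Morrey norm is taken in the extended reals, so it is
  \<open>\<infinity>\<close> exactly when \<open>x\<close> does not belong to the space.\<close>

definition morrey_norm :: "(int \<Rightarrow> real) \<Rightarrow> real \<Rightarrow> real \<Rightarrow> (int \<Rightarrow> real) \<Rightarrow> ereal" where
  "morrey_norm \<omega> p q x =
     (SUP (m, N) \<in> UNIV. ereal
        (sum \<omega> (sym_interval m N) powr (1 / q - 1 / p) *
         (\<Sum>k\<in>sym_interval m N. \<bar>x k\<bar> powr p * \<omega> k) powr (1 / p)))"

definition morrey_space :: "(int \<Rightarrow> real) \<Rightarrow> real \<Rightarrow> real \<Rightarrow> (int \<Rightarrow> real) set" where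
  "morrey_space \<omega> p q = {x. morrey_norm \<omega> p q x < \<infinity>}"

definition maximal_op :: "(int \<Rightarrow> real) \<Rightarrow> int \<Rightarrow> ereal" where
  "maximal_op x m =
     (SUP N. ereal (1 / real (card (sym_interval m N)) * (\<Sum>k\<in>sym_interval m N. \<bar>x k\<bar>)))"

text \<open>The maximal function takes values in the extended reals. That it belongs to the Morrey
  space, which consists of real sequences, includes that all its values are finite, i.e. that
  it is given by a real sequence \<open>y\<close>.\<close>

definition maximal_op_bounded_on_morrey :: "(int \<Rightarrow> real) \<Rightarrow> real \<Rightarrow> real \<Rightarrow> bool" where
  "maximal_op_bounded_on_morrey \<omega> p q \<longleftrightarrow>
     (\<exists>C::real. C > 0 \<and>
       (\<forall>x\<in>morrey_space \<omega> p q.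
          \<exists>y\<in>morrey_space \<omega> p q.
            (\<forall>m. maximal_op x m = ereal (y m)) \<and>
            morrey_norm \<omega> p q y \<le> ereal C * morrey_norm \<omega> p q x))"

definition power_weight :: "real \<Rightarrow> int \<Rightarrow> real" where
  "power_weight \<beta> k = (if k = 0 then 1 else \<bar>real_of_int k\<bar> powr \<beta>)"

end

theory Submission imports Defs "HOL-Analysis.Analysis" begin

text \<open>
  Replace \<open>\<omega>\<close> by the comparable weight \<open>(|k| + 1) powr \<beta>\<close> and call a ball with centre \<open>m\<close> and
  radius \<open>N\<close> away from the origin if \<open>4 N \<le> |m|\<close>, so that the weight is essentially constant on it.
  An estimate of the form \<open>B (N + 1) powr a * (|m| + N + 1) powr b\<close> with \<open>a \<ge> 0\<close> and \<open>a + b > 0\<close> for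
  the sums of a nonnegative function over balls away from the origin extends to all balls, because
  the annuli around the origin contribute a geometric series. For \<open>-1 < \<beta> < q - 1\<close> this principle
  is applied to the weight itself (using \<open>\<beta> > -1\<close>), to \<open>x\<close> (using \<open>\<beta> < q - 1\<close>) and
  to \<open>(Mx)\<^sup>p \<omega>\<close> (using \<open>\<beta> > -1\<close> and \<open>p < q\<close>). On a ball away from the
  origin, the averages over small balls are controlled by the unweighted \<open>l\<^sup>p\<close> inequality for one-sided
  maximal functions, and the averages over large balls by the bound for the sums of \<open>x\<close>.

  Conversely, by Hoelder's inequality the Morrey norm is at most the norm of \<open>l\<^sup>q(\<omega>)\<close>. Testing with
  the indicator function of \<open>{K..2K}\<close> if \<open>\<beta> \<le> -1\<close>, and with \<open>1/k\<close> on \<open>{1..K}\<close> if \<open>\<beta> \<ge> q - 1\<close>,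
  would bound the harmonic numbers.
\<close>

subsection \<open>The one-sided maximal function\<close>

text \<open>Young's inequality is applied termwise to \<open>x k / t\<close> and the constant 1,
  with a scale \<open>t\<close> that balances the two resulting sums. If one of the two factors on
  the right vanishes, every term on the left vanishes too.\<close>

lemma weighted_Hoelder_sum:
  fixes x w :: "'a \<Rightarrow> real"
  assumes "finite S" and r: "r > 1" and x: "\<And>k. k \<in> S \<Longrightarrow> 0 \<le> x k" and w: "\<And>k. k \<in> S \<Longrightarrow> 0 \<le> w k"
  shows "(\<Sum>k\<in>S. x k * w k) \<le> (\<Sum>k\<in>S. x k powr r * w k) powr (1/r) * (\<Sum>k\<in>S. w k) powr (1 - 1/r)"
proof -
  define U where "U = (\<Sum>k\<in>S. x k powr r * w k)"
  define V where "V = (\<Sum>k\<in>S. w k)"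
  have U0: "U \<ge> 0" and V0: "V \<ge> 0" unfolding U_def V_def by (auto intro!: sum_nonneg mult_nonneg_nonneg w)
  show ?thesis
  proof (cases "U = 0 \<or> V = 0")
    case True
    have "x k * w k = 0" if "k \<in> S" for k
    proof -
      have "x k powr r * w k = 0 \<or> w k = 0"
        using True that assms(1) w unfolding U_def V_def
        by (subst (asm) (1 2) sum_nonneg_eq_0_iff) auto
      then show ?thesis by auto
    qed
    then have "(\<Sum>k\<in>S. x k * w k) = 0" by (intro sum.neutral) auto
    then show ?thesis by (simp add: U_def V_def)
  next
    case False
    then have U: "U > 0" and V: "V > 0" using U0 V0 by auto
    \<comment> \<open>With this scale \<open>t powr r = U / V\<close>, so the two sums from Young's
      inequality become \<open>V / r\<close> and \<open>(1 - 1/r) * V\<close>.\<close>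
    define t where "t = (U / V) powr (1/r)"
    have t: "t > 0" using U V by (simp add: t_def)
    have tr: "t powr r = U / V" using U V r by (simp add: t_def powr_powr)
    have "(\<Sum>k\<in>S. x k * w k) / t = (\<Sum>k\<in>S. (x k / t) * 1 * w k)"
      by (simp add: sum_divide_distrib)
    also have "\<dots> \<le> (\<Sum>k\<in>S. ((x k / t) powr r / r + 1 powr (r/(r-1)) / (r/(r-1))) * w k)"
      using r t x w
      by (intro sum_mono mult_right_mono Youngs_inequality) (auto simp: field_simps)
    also have "\<dots> = (\<Sum>k\<in>S. x k powr r * w k / (t powr r * r) + (1 - 1/r) * w k)"
      using r t x by (intro sum.cong) (auto simp: powr_divide field_simps)
    also have "\<dots> = U / (t powr r * r) + (1 - 1/r) * V"
      by (simp add: sum.distrib U_def V_def sum_divide_distrib sum_distrib_left)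
    also have "\<dots> = V" using U V r by (simp add: tr field_simps)
    finally have "(\<Sum>k\<in>S. x k * w k) \<le> t * V" using t by (simp add: field_simps)
    also have "t * V = U powr (1/r) * V powr (1 - 1/r)"
      using U V by (simp add: t_def powr_divide powr_diff)
    finally show ?thesis by (simp add: U_def V_def)
  qed
qed

lemma add_powr_le:
  fixes a b r :: real
  assumes "0 \<le> a" "0 \<le> b" "0 \<le> r"
  shows "(a + b) powr r \<le> 2 powr r * (a powr r + b powr r)"
proof -
  have "(a + b) powr r \<le> (2 * max a b) powr r" using assms by (intro powr_mono2) auto
  also have "\<dots> = 2 powr r * max a b powr r" using assms by (simp add: powr_mult)
  also have "\<dots> \<le> 2 powr r * (a powr r + b powr r)"
    by (intro mult_left_mono) (auto simp: max_def)
  finally show ?thesis .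
qed

text \<open>The absolute value in the exponent lets one constant serve both signs of
  \<open>s\<close>; later estimates then need no case distinction on the sign of
  \<open>\<beta>\<close>.\<close>

lemma powr_le_of_comparable:
  fixes a b c s :: real
  assumes "0 < a" "0 < b" "a \<le> c * b" "b \<le> c * a"
  shows "a powr s \<le> c powr \<bar>s\<bar> * b powr s"
proof -
  have c: "c > 0" using assms by (smt (verit) mult_nonneg_nonneg zero_less_mult_pos2)
  show ?thesis
  proof (cases "s \<ge> 0")
    case True
    then have "a powr s \<le> (c * b) powr s" using assms by (intro powr_mono2) auto
    then show ?thesis using True c assms by (simp add: powr_mult)
  next
    case False
    then have "a powr s \<le> (b / c) powr s" using assms c by (intro powr_mono2') (auto simp: field_simps)
    then show ?thesis using False c assms by (simp add: powr_divide powr_minus divide_simps)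
  qed
qed

section \<open>Averages over windows with a fixed right end, and their \<open>l^p\<close>
  bound\<close>

definition average :: "(nat \<Rightarrow> real) \<Rightarrow> nat \<Rightarrow> nat \<Rightarrow> real" where
  "average f j i = (\<Sum>k=j..i. f k) / real (Suc i - j)"

text \<open>Indices are natural numbers, so only finitely many windows end at \<open>i\<close> and a
  maximum replaces the supremum.\<close>

definition left_max :: "(nat \<Rightarrow> real) \<Rightarrow> nat \<Rightarrow> real" where
  "left_max f i = Max ((\<lambda>j. average f j i) ` {..i})"

lemma average_le_left_max: "j \<le> i \<Longrightarrow> average f j i \<le> left_max f i"
  unfolding left_max_def by (rule Max_ge) auto

lemma left_max_nonneg: "(\<And>i. f i \<ge> 0) \<Longrightarrow> 0 \<le> left_max f i"
  by (rule order_trans[OF _ average_le_left_max[of i i]]) (auto simp: average_def)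

text \<open>The largest of the sums of \<open>g\<close> over \<open>{j..i}\<close>, \<open>j \<le> i\<close>; the recursion makes the
  maximal inequality \<open>rising_sun\<close> a telescoping sum.\<close>

fun rising :: "(nat \<Rightarrow> real) \<Rightarrow> nat \<Rightarrow> real" where
  "rising g 0 = g 0"
| "rising g (Suc i) = max 0 (rising g i) + g (Suc i)"

lemma sum_le_rising: "j \<le> i \<Longrightarrow> (\<Sum>k=j..i. g k) \<le> rising g i"
proof (induction i)
  case (Suc i)
  then show ?case by (cases "j = Suc i") auto
qed auto

lemma rising_eq_sum: "\<exists>j\<le>i. rising g i = (\<Sum>k=j..i. g k)"
proof (induction i)
  case (Suc i)
  then obtain j where *: "j \<le> i" "rising g i = (\<Sum>k=j..i. g k)" by auto
  then show ?case
  proof (cases "rising g i \<ge> 0")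
    case True
    then show ?thesis using * by (intro exI[of _ j]) auto
  next
    case False
    then show ?thesis by (intro exI[of _ "Suc i"]) auto
  qed
qed auto

text \<open>An average is at least \<open>l\<close> exactly when the sum of \<open>f k - l\<close>
  over its window is nonnegative, so superlevel sets of the maximal function are read off from the
  sign of \<open>rising\<close>.\<close>

lemma le_left_max_iff: "l \<le> left_max f i \<longleftrightarrow> rising (\<lambda>k. f k - l) i \<ge> 0"
proof -
  have *: "l \<le> average f j i \<longleftrightarrow> (\<Sum>k=j..i. f k - l) \<ge> 0" if "j \<le> i" for j
    using that by (simp add: average_def sum_subtractf field_simps of_nat_diff)
  have "l \<le> left_max f i \<longleftrightarrow> (\<exists>j\<le>i. l \<le> average f j i)"
    unfolding left_max_def by (subst Max_ge_iff) auto
  also have "\<dots> \<longleftrightarrow> (\<exists>j\<le>i. (\<Sum>k=j..i. f k - l) \<ge> 0)" using * by auto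
  also have "\<dots> \<longleftrightarrow> rising (\<lambda>k. f k - l) i \<ge> 0"
    using sum_le_rising[of _ i "\<lambda>k. f k - l"] rising_eq_sum[of i "\<lambda>k. f k - l"] by force
  finally show ?thesis .
qed

lemma rising_sun:
  "0 \<le> (\<Sum>i\<le>n. if l \<le> left_max f i then f i - l else 0)"
proof -
  \<comment> \<open>The bound 0 is strengthened to carry the induction: if \<open>rising\<close> is
    nonnegative at \<open>Suc n\<close>, both sides grow appropriately by
    \<open>f (Suc n) - l\<close>; otherwise the left side drops to 0 and the sum stays
    unchanged.\<close>
  have "max 0 (rising (\<lambda>k. f k - l) n) \<le> (\<Sum>i\<le>n. if rising (\<lambda>k. f k - l) i \<ge> 0 then f i - l else 0)"
  proof (induction n)
    case 0
    show ?case unfolding atMost_0 by simp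
  next
    case (Suc n)
    then show ?case by (auto simp: max_def split: if_splits)
  qed
  then show ?thesis unfolding le_left_max_iff by linarith
qed

text \<open>Multiply \<open>rising_sun\<close> by \<open>l powr (p - 2)\<close> and integrate over \<open>l\<close>.\<close>

lemma left_max_powr_le:
  assumes f: "\<And>i. f i \<ge> 0" and p: "p > 1"
  shows "(\<Sum>i\<le>n. left_max f i powr p / p) \<le> (\<Sum>i\<le>n. f i * left_max f i powr (p - 1) / (p - 1))"
proof -
  \<comment> \<open>A common upper bound for all values of the maximal function, so that the
    integrals for the different \<open>i\<close> run over one interval.\<close>
  define B where "B = (\<Sum>i\<le>n. left_max f i)"
  have gB: "left_max f i \<le> B" if "i \<le> n" for i
    unfolding B_def using that f by (intro member_le_sum) (auto intro: left_max_nonneg)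
  have int: "((\<lambda>l. if l \<le> left_max f i then l powr (p - 2) * (f i - l) else 0)
      has_integral (f i * left_max f i powr (p - 1) / (p - 1) - left_max f i powr p / p)) {0..B}" 
    if i: "i \<in> {..n}" for i
  proof -
    define g where "g = left_max f i"
    have g: "0 \<le> g" "g \<le> B" using gB i f by (auto simp: g_def intro: left_max_nonneg)
    \<comment> \<open>The exponent \<open>p - 2\<close> may be negative, but \<open>p > 1\<close>
      keeps it above -1, so the singularity at 0 is integrable.\<close>
    have "((\<lambda>l. f i * l powr (p - 2) - l powr (p - 1)) has_integral 
       (f i * (g powr (p - 2 + 1) / (p - 2 + 1)) - g powr (p - 1 + 1) / (p - 1 + 1))) {0..g}"
      using p g by (intro has_integral_diff has_integral_mult_right has_integral_powr_from_0) auto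
    then have "((\<lambda>l. f i * l powr (p - 2) - l powr (p - 1)) has_integral 
       (f i * g powr (p - 1) / (p - 1) - g powr p / p)) {0..g}" by simp
    then have "((\<lambda>l. l powr (p - 2) * (f i - l)) has_integral 
       (f i * g powr (p - 1) / (p - 1) - g powr p / p)) {0..g}"
    proof (rule has_integral_eq[rotated, where g = "\<lambda>l. l powr (p - 2) * (f i - l)"])
      fix l assume "l \<in> {0..g}"
      then have "l powr (p - 1) = l powr (p - 2) * l"
        using powr_mult_base[of l "p - 2"] by (simp add: mult.commute)
      then show "f i * l powr (p - 2) - l powr (p - 1) = l powr (p - 2) * (f i - l)"
        by (simp add: algebra_simps)
    qed
    then have "((\<lambda>l. if l \<in> {0..g} then l powr (p - 2) * (f i - l) else 0) has_integral 
       (f i * g powr (p - 1) / (p - 1) - g powr p / p)) {0..B}"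
      using g by (intro has_integral_restrict[THEN iffD2]) auto
    then show ?thesis unfolding g_def[symmetric]
      by (rule has_integral_eq[rotated]) auto
  qed
  have "0 \<le> (\<Sum>i\<le>n. f i * left_max f i powr (p - 1) / (p - 1) - left_max f i powr p / p)"
  proof (rule has_integral_nonneg[OF has_integral_sum[OF _ int]])
    fix l assume "l \<in> {0..B}"
    have "0 \<le> l powr (p - 2) * (\<Sum>i\<le>n. if l \<le> left_max f i then f i - l else 0)"
      by (intro mult_nonneg_nonneg rising_sun) auto
    also have "\<dots> = (\<Sum>i\<le>n. if l \<le> left_max f i then l powr (p - 2) * (f i - l) else 0)"
      by (auto simp: sum_distrib_left intro!: sum.cong)
    finally show "0 \<le> (\<Sum>i\<le>n. if l \<le> left_max f i then l powr (p - 2) * (f i - l) else 0)" .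
  qed auto
  then show ?thesis by (simp add: sum_subtractf)
qed

text \<open>If \<open>2 * c * a \<le> g\<close>, the left side is at most half of
  \<open>g powr p\<close>; otherwise \<open>g\<close> is bounded by a multiple of \<open>a\<close>.
  The factor 1/2 permits absorption into the left side of the maximal inequality.\<close>

lemma Young_absorb:
  fixes a g c p :: real
  assumes "0 \<le> a" "0 \<le> g" "c > 0" "p > 1"
  shows "c * (a * g powr (p - 1)) \<le> g powr p / 2 + c * (2 * c) powr (p - 1) * a powr p"
proof -
  have pw: "y powr p = y * y powr (p - 1)" if "y \<ge> 0" for y :: real
    using that by (simp add: powr_mult_base)
  show ?thesis
  proof (cases "2 * c * a \<le> g")
    case True
    then have "2 * c * a * g powr (p - 1) \<le> g * g powr (p - 1)" by (intro mult_right_mono) auto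
    then have "c * (a * g powr (p - 1)) \<le> g powr p / 2" using pw[OF assms(2)] by simp
    moreover have "0 \<le> c * (2 * c) powr (p - 1) * a powr p" using assms by simp
    ultimately show ?thesis by linarith
  next
    case False
    then have "g powr (p - 1) \<le> (2 * c * a) powr (p - 1)" using assms by (intro powr_mono2) auto
    then have "c * (a * g powr (p - 1)) \<le> c * (a * ((2 * c) powr (p - 1) * a powr (p - 1)))"
      using assms by (intro mult_left_mono) (auto simp: powr_mult)
    also have "\<dots> = c * (2 * c) powr (p - 1) * a powr p" using pw[OF assms(1)] by simp
    finally have "c * (a * g powr (p - 1)) \<le> c * (2 * c) powr (p - 1) * a powr p" .
    then show ?thesis by (smt (verit) powr_ge_zero divide_nonneg_pos)
  qed
qed

text \<open>Half of the sum on the left reappears on the right after \<open>Young_absorb\<close> and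
  is subtracted, which is legitimate because the sum is finite. The constant depends on
  \<open>p\<close> alone.\<close>

lemma left_max_lp_bound:
  assumes p: "p > (1::real)"
  shows "\<exists>C>0. \<forall>f n. (\<forall>i. f i \<ge> 0) \<longrightarrow> (\<Sum>i\<le>n. left_max f i powr p) \<le> C * (\<Sum>i\<le>n. f i powr p)"
proof -
  define c where "c = p / (p - 1)"
  have c: "c > 0" using p by (simp add: c_def)
  show ?thesis
  proof (intro exI[of _ "2 * (c * (2 * c) powr (p - 1))"] conjI allI impI)
    show "0 < 2 * (c * (2 * c) powr (p - 1))" using c by simp
    fix f :: "nat \<Rightarrow> real" and n assume f: "\<forall>i. f i \<ge> 0"
    let ?G = "\<Sum>i\<le>n. left_max f i powr p"
    have "?G = p * (\<Sum>i\<le>n. left_max f i powr p / p)" using p by (simp add: sum_distrib_left)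
    also have "\<dots> \<le> p * (\<Sum>i\<le>n. f i * left_max f i powr (p - 1) / (p - 1))"
      using f p by (intro mult_left_mono left_max_powr_le) auto
    also have "\<dots> = (\<Sum>i\<le>n. c * (f i * left_max f i powr (p - 1)))"
      by (simp add: sum_distrib_left c_def)
    also have "\<dots> \<le> (\<Sum>i\<le>n. left_max f i powr p / 2 + c * (2 * c) powr (p - 1) * f i powr p)"
      using f p c by (intro sum_mono Young_absorb) (auto intro: left_max_nonneg)
    also have "\<dots> = ?G / 2 + c * (2 * c) powr (p - 1) * (\<Sum>i\<le>n. f i powr p)"
      by (simp add: sum.distrib sum_divide_distrib sum_distrib_left)
    finally show "?G \<le> 2 * (c * (2 * c) powr (p - 1)) * (\<Sum>i\<le>n. f i powr p)" by simp
  qed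
qed

subsection \<open>Sums over balls\<close>

lemma sym_interval_eq: "sym_interval m N = {m - int N..m + int N}"
  by (auto simp: sym_interval_def)

lemma finite_sym_interval [simp]: "finite (sym_interval m N)"
  by (simp add: sym_interval_eq)

lemma card_sym_interval: "card (sym_interval m N) = 2 * N + 1"
  by (simp add: sym_interval_eq)

lemma center_in_sym_interval [simp]: "m \<in> sym_interval m N"
  by (simp add: sym_interval_def)

lemma sym_interval_mono: "\<bar>m - m'\<bar> + int N \<le> int N' \<Longrightarrow> sym_interval m N \<subseteq> sym_interval m' N'"
  by (auto simp: sym_interval_def)

section \<open>From balls away from the origin to all balls\<close>

text \<open>Each step shrinks \<open>R + 1\<close> at least by the factor 4/5. As
  \<open>s > 0\<close>, the contributions are dominated by a geometric series with ratio
  \<open>(4/5) powr s\<close>.\<close>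

lemma geometric_growth:
  fixes F :: "nat \<Rightarrow> real"
  assumes s: "s > 0" and B: "B \<ge> 0" and F0: "F 0 \<le> B"
    and step: "\<And>R. R \<ge> 1 \<Longrightarrow> F R \<le> F (R - 2 * (R div 5) - 1) + B * (real R + 1) powr s"
  shows "F R \<le> B * (real R + 1) powr s / (1 - (4/5) powr s)"
proof (induction R rule: less_induct)
  case (less R)
  define r :: real where "r = (4/5) powr s"
  have r: "0 < r" "r < 1" using s powr_less_mono2[of s "4/5::real" 1] by (auto simp: r_def)
  show ?case
  proof (cases "R = 0")
    case True
    have "B * 1 \<le> B * (1 / (1 - r))" using r B by (intro mult_left_mono) auto
    then show ?thesis using True F0 by (simp add: r_def)
  next
    case False
    define R' where "R' = R - 2 * (R div 5) - 1"
    have "5 * (R' + 1) \<le> 4 * (R + 1)" 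
    proof -
      define N where "N = R div 5"
      have "5 * N \<le> R" "R \<le> 5 * N + 4" by (auto simp: N_def)
      \<comment> \<open>This excludes truncation in the natural-number subtraction that defines
        \<open>R'\<close>.\<close>
      moreover from this False have "2 * N + 1 \<le> R" by (cases N) auto
      ultimately show ?thesis unfolding R'_def N_def[symmetric] by simp
    qed
    then have "real (5 * (R' + 1)) \<le> real (4 * (R + 1))" by (rule of_nat_mono)
    then have "(real R' + 1) powr s \<le> ((4/5) * (real R + 1)) powr s"
      using s by (intro powr_mono2) auto
    then have R': "(real R' + 1) powr s \<le> r * (real R + 1) powr s"
      unfolding r_def by (subst (asm) powr_mult) auto
    have "F R \<le> F R' + B * (real R + 1) powr s"
      using step False unfolding R'_def by auto
    also have "F R' \<le> B * (real R' + 1) powr s / (1 - r)"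
      unfolding r_def using False by (intro less) (auto simp: R'_def)
    also have "\<dots> \<le> B * (r * (real R + 1) powr s) / (1 - r)"
      using B r R' by (intro divide_right_mono mult_left_mono) auto
    also have "B * (r * (real R + 1) powr s) / (1 - r) + B * (real R + 1) powr s
      = B * (real R + 1) powr s / (1 - r)"
      using r by (simp add: field_simps)
    finally show ?thesis by (simp add: r_def)
  qed
qed

text \<open>With \<open>N = R div 5\<close>, the two end pieces of the centred ball are balls of
  radius \<open>N\<close> around \<open>R - N\<close> and \<open>-(R - N)\<close>. They are away
  from the origin, and removing them leaves the centred ball of radius \<open>R - 2 * N - 1\<close>.
  The two sides account for the factor 2.\<close>

lemma sum_centered_le:
  fixes f :: "int \<Rightarrow> real"
  assumes f: "\<And>k. f k \<ge> 0" and s: "s > 0" and B: "B \<ge> 0"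
    and away: "\<And>m N. 4 * int N \<le> \<bar>m\<bar> \<Longrightarrow> (\<Sum>k\<in>sym_interval m N. f k) \<le> B * (real_of_int \<bar>m\<bar> + 1) powr s"
  shows "(\<Sum>k\<in>sym_interval 0 R. f k) \<le> 2 * B * (real R + 1) powr s / (1 - (4/5) powr s)"
proof (rule geometric_growth[OF s])
  show "0 \<le> 2 * B" using B by simp
  have "(\<Sum>k\<in>sym_interval 0 0. f k) \<le> B * (real_of_int \<bar>0\<bar> + 1) powr s"
    by (rule away) auto
  then show "(\<Sum>k\<in>sym_interval 0 0. f k) \<le> 2 * B" using B by simp
  fix R :: nat assume R: "R \<ge> 1"
  define N where "N = R div 5"
  define R' where "R' = R - 2 * N - 1"
  define m where "m = int R - int N"
  have N: "5 * N \<le> R" by (simp add: N_def)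
  have R'_eq: "int R' = int R - 2 * int N - 1" using R N by (simp add: R'_def of_nat_diff)
  have side: "(\<Sum>k\<in>sym_interval m' N. f k) \<le> B * (real R + 1) powr s" if "\<bar>m'\<bar> = m" for m'
  proof -
    have "(\<Sum>k\<in>sym_interval m' N. f k) \<le> B * (real_of_int \<bar>m'\<bar> + 1) powr s"
      using that N by (intro away) (auto simp: m_def)
    also have "\<dots> \<le> B * (real R + 1) powr s"
      using that B s N by (intro mult_left_mono powr_mono2) (auto simp: m_def)
    finally show ?thesis .
  qed
  have "sym_interval 0 R \<subseteq> sym_interval 0 R' \<union> (sym_interval m N \<union> sym_interval (-m) N)"
    using R'_eq N by (auto simp: sym_interval_eq m_def)
  then have "(\<Sum>k\<in>sym_interval 0 R. f k) \<le> (\<Sum>k\<in>sym_interval 0 R' \<union> (sym_interval m N \<union> sym_interval (-m) N). f k)"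
    by (intro sum_mono2) (auto intro: f)
  also have "\<dots> \<le> (\<Sum>k\<in>sym_interval 0 R'. f k) + (\<Sum>k\<in>(sym_interval m N \<union> sym_interval (-m) N). f k)"
    using f by (subst sum_Un) (auto intro!: sum_nonneg)
  also have "(\<Sum>k\<in>(sym_interval m N \<union> sym_interval (-m) N). f k)
     \<le> (\<Sum>k\<in>sym_interval m N. f k) + (\<Sum>k\<in>sym_interval (-m) N. f k)"
    using f by (subst sum_Un) (auto intro!: sum_nonneg)
  also have "\<dots> \<le> B * (real R + 1) powr s + B * (real R + 1) powr s"
    using N by (intro add_mono side) (auto simp: m_def)
  finally show "(\<Sum>k\<in>sym_interval 0 R. f k) \<le> (\<Sum>k\<in>sym_interval 0 (R - 2 * (R div 5) - 1). f k) + 2 * B * (real R + 1) powr s"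
    by (simp add: R'_def N_def)
qed

text \<open>The two exponents make this family closed under products and powers. With exponents 1
  and \<open>\<beta> > -1\<close> it is comparable to the weight of the ball; with exponents 0 and
  \<open>\<beta>\<close> it is comparable to the weight at each point of a ball away from the
  origin.\<close>

definition ball_size :: "real \<Rightarrow> real \<Rightarrow> int \<Rightarrow> nat \<Rightarrow> real" where
  "ball_size a b m N = (real N + 1) powr a * (real_of_int \<bar>m\<bar> + real N + 1) powr b"

lemma ball_size_nonneg [simp]: "0 \<le> ball_size a b m N"
  by (simp add: ball_size_def)

lemma ball_size_pos [simp]: "0 < ball_size a b m N"
proof -
  have "real_of_int \<bar>m\<bar> + real N + 1 > 0" by (simp add: add_nonneg_pos)
  then show ?thesis by (simp add: ball_size_def)
qed

lemma ball_size_powr: "ball_size a b m N powr c = ball_size (a * c) (b * c) m N"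
  by (simp add: ball_size_def powr_mult powr_powr)

lemma ball_size_mult: "ball_size a b m N * ball_size a' b' m N = ball_size (a + a') (b + b') m N"
  by (simp add: ball_size_def powr_add)

text \<open>A ball that is not away from the origin lies in a centred ball of comparable radius, to
  which \<open>sum_centered_le\<close> applies with exponent \<open>a + b\<close>. The constant is
  uniform in \<open>f\<close> and \<open>B\<close>.\<close>

lemma sum_le_ball_size_of_away:
  fixes a b :: real
  assumes a: "a \<ge> 0" and ab: "a + b > 0"
  shows "\<exists>C>0. \<forall>f B. (\<forall>k. f k \<ge> 0) \<longrightarrow> B \<ge> 0 \<longrightarrow>
    (\<forall>m N. 4 * int N \<le> \<bar>m\<bar> \<longrightarrow> (\<Sum>k\<in>sym_interval m N. f k) \<le> B * ball_size a b m N) \<longrightarrow>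
    (\<forall>m N. (\<Sum>k\<in>sym_interval m N. f k) \<le> C * B * ball_size a b m N)"
proof -
  define K where "K = 2 * 2 powr \<bar>b\<bar> / (1 - (4/5) powr (a + b))"
  have K: "K > 0" using ab powr_less_mono2[of "a + b" "4/5::real" 1] by (simp add: K_def)
  define C where "C = max 1 (5 powr a * K)"
  show ?thesis
  proof (intro exI[of _ C] conjI allI impI)
    show "C > 0" by (simp add: C_def)
    fix f :: "int \<Rightarrow> real" and B m N
    assume f: "\<forall>k. f k \<ge> 0" and B: "B \<ge> 0"
      and away: "\<forall>m N. 4 * int N \<le> \<bar>m\<bar> \<longrightarrow> (\<Sum>k\<in>sym_interval m N. f k) \<le> B * ball_size a b m N"
    show "(\<Sum>k\<in>sym_interval m N. f k) \<le> C * B * ball_size a b m N"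
    proof (cases "4 * int N \<le> \<bar>m\<bar>")
      case True
      then have "(\<Sum>k\<in>sym_interval m N. f k) \<le> B * ball_size a b m N" using away by blast
      also have "\<dots> \<le> C * (B * ball_size a b m N)"
        using B mult_right_mono[of 1 C "B * ball_size a b m N"] by (simp add: C_def)
      finally show ?thesis by (simp add: mult.assoc)
    next
      case False
      define R where "R = nat \<bar>m\<bar> + N"
      have R: "real R = real_of_int \<bar>m\<bar> + real N" by (simp add: R_def)
      have "(\<Sum>k\<in>sym_interval m N. f k) \<le> (\<Sum>k\<in>sym_interval 0 R. f k)"
        using f by (intro sum_mono2 sym_interval_mono) (auto simp: R_def)
      also have "\<dots> \<le> 2 * (B * 2 powr \<bar>b\<bar>) * (real R + 1) powr (a + b) / (1 - (4/5) powr (a + b))"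
      proof (rule sum_centered_le)
        fix m N assume mN: "4 * int N \<le> \<bar>m\<bar>"
        then have mN': "4 * real N \<le> real_of_int \<bar>m\<bar>" by linarith
        have "(\<Sum>k\<in>sym_interval m N. f k) \<le> B * ((real N + 1) powr a * (real_of_int \<bar>m\<bar> + real N + 1) powr b)"
          using away mN by (auto simp: ball_size_def)
        \<comment> \<open>Away from the origin \<open>N \<le> |m|\<close>, and
          \<open>|m| + N + 1\<close> is comparable to \<open>|m| + 1\<close> with constant
          2.\<close>
        also have "\<dots> \<le> B * ((real_of_int \<bar>m\<bar> + 1) powr a * (2 powr \<bar>b\<bar> * (real_of_int \<bar>m\<bar> + 1) powr b))"
          using B a mN' by (intro mult_left_mono mult_mono powr_mono2 powr_le_of_comparable) auto
        also have "\<dots> = B * 2 powr \<bar>b\<bar> * (real_of_int \<bar>m\<bar> + 1) powr (a + b)"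
          by (simp add: powr_add)
        finally show "(\<Sum>k\<in>sym_interval m N. f k) \<le> B * 2 powr \<bar>b\<bar> * (real_of_int \<bar>m\<bar> + 1) powr (a + b)" .
      qed (use f B ab in auto)
      also have "\<dots> = B * K * (real R + 1) powr b * (real R + 1) powr a"
        by (simp add: K_def powr_add)
      \<comment> \<open>Here \<open>|m| < 4 * N\<close>, hence
        \<open>R + 1 \<le> 5 * (N + 1)\<close>.\<close>
      also have "\<dots> \<le> B * K * (real R + 1) powr b * (5 * (real N + 1)) powr a"
        using False B K a by (intro mult_left_mono powr_mono2) (auto simp: R)
      also have "\<dots> = (5 powr a * K) * (B * ball_size a b m N)"
        by (simp add: ball_size_def R powr_mult[of 5 "real N + 1"] del: distrib_left_numeral)
      also have "\<dots> \<le> C * (B * ball_size a b m N)"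
        using B by (intro mult_right_mono) (auto simp: C_def)
      finally show ?thesis by (simp add: mult.assoc)
    qed
  qed
qed

section \<open>The shifted power weight on balls\<close>

definition shifted_weight :: "real \<Rightarrow> int \<Rightarrow> real" where
  "shifted_weight \<beta> k = (real_of_int \<bar>k\<bar> + 1) powr \<beta>"

lemma shifted_weight_pos [simp]: "0 < shifted_weight \<beta> k"
  by (simp add: shifted_weight_def add_nonneg_pos)

lemma shifted_weight_nonneg [simp]: "0 \<le> shifted_weight \<beta> k"
  by (simp add: less_imp_le)

text \<open>On such a ball \<open>|k| + 1\<close> and \<open>|m| + N + 1\<close> differ at most by
  the factor 3. The factor 2 in the hypothesis, instead of 4, makes the estimate available on the
  double of a ball away from the origin.\<close>

lemma shifted_weight_away:
  assumes "2 * int N \<le> \<bar>m\<bar>" "k \<in> sym_interval m N"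
  shows "shifted_weight s k \<le> 3 powr \<bar>s\<bar> * ball_size 0 s m N"
    and "ball_size 0 s m N \<le> 3 powr \<bar>s\<bar> * shifted_weight s k"
proof -
  have "\<bar>k\<bar> + 1 \<le> 3 * (\<bar>m\<bar> + int N + 1)" "\<bar>m\<bar> + int N + 1 \<le> 3 * (\<bar>k\<bar> + 1)"
    using assms by (auto simp: sym_interval_def)
  then have "real_of_int (\<bar>k\<bar> + 1) \<le> real_of_int (3 * (\<bar>m\<bar> + int N + 1))"
       "real_of_int (\<bar>m\<bar> + int N + 1) \<le> real_of_int (3 * (\<bar>k\<bar> + 1))"
    by (simp_all only: of_int_le_iff)
  then show "shifted_weight s k \<le> 3 powr \<bar>s\<bar> * ball_size 0 s m N"
    "ball_size 0 s m N \<le> 3 powr \<bar>s\<bar> * shifted_weight s k"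
    unfolding shifted_weight_def ball_size_def by (auto intro!: powr_le_of_comparable)
qed

lemma sum_shifted_weight_le:
  assumes "\<beta> > -1"
  shows "\<exists>C>0. \<forall>m N. (\<Sum>k\<in>sym_interval m N. shifted_weight \<beta> k) \<le> C * ball_size 1 \<beta> m N"
proof -
  obtain C where C: "C > 0" and all: "\<forall>f B. (\<forall>k. f k \<ge> 0) \<longrightarrow> B \<ge> 0 \<longrightarrow>
    (\<forall>m N. 4 * int N \<le> \<bar>m\<bar> \<longrightarrow> (\<Sum>k\<in>sym_interval m N. f k) \<le> B * ball_size 1 \<beta> m N) \<longrightarrow>
    (\<forall>m N. (\<Sum>k\<in>sym_interval m N. f k) \<le> C * B * ball_size 1 \<beta> m N)"
    using sum_le_ball_size_of_away[of 1 \<beta>] assms by force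
  have "(\<Sum>k\<in>sym_interval m N. shifted_weight \<beta> k) \<le> C * (2 * 3 powr \<bar>\<beta>\<bar>) * ball_size 1 \<beta> m N" for m N
  proof (intro all[rule_format])
    fix m N assume mN: "4 * int N \<le> \<bar>m\<bar>"
    have "(\<Sum>k\<in>sym_interval m N. shifted_weight \<beta> k) \<le> (\<Sum>k\<in>sym_interval m N. 3 powr \<bar>\<beta>\<bar> * ball_size 0 \<beta> m N)"
      using mN by (intro sum_mono shifted_weight_away) auto
    also have "\<dots> = (2 * real N + 1) * (3 powr \<bar>\<beta>\<bar> * ball_size 0 \<beta> m N)"
      by (simp add: card_sym_interval)
    also have "\<dots> \<le> (2 * (real N + 1)) * (3 powr \<bar>\<beta>\<bar> * ball_size 0 \<beta> m N)"
      by (intro mult_right_mono) auto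
    also have "\<dots> = 2 * 3 powr \<bar>\<beta>\<bar> * ball_size 1 \<beta> m N" by (simp add: ball_size_def)
    finally show "(\<Sum>k\<in>sym_interval m N. shifted_weight \<beta> k) \<le> 2 * 3 powr \<bar>\<beta>\<bar> * ball_size 1 \<beta> m N" .
  qed auto
  then show ?thesis using C by (intro exI[of _ "C * (2 * 3 powr \<bar>\<beta>\<bar>)"]) auto
qed

text \<open>The part of the ball on the far side from the origin already has enough weight, whatever
  the sign of \<open>\<beta>\<close>.\<close>

lemma sum_shifted_weight_ge:
  "ball_size 1 \<beta> m N \<le> 2 * 3 powr \<bar>\<beta>\<bar> * (\<Sum>k\<in>sym_interval m N. shifted_weight \<beta> k)"
proof -
  \<comment> \<open>The outermost \<open>N div 2 + 1\<close> points on the side away from the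
    origin; there \<open>|k| + 1\<close> is comparable to \<open>|m| + N + 1\<close>.\<close>
  define T where "T = (if m \<ge> 0 then {m + int N - int (N div 2)..m + int N}
                       else {m - int N..m - int N + int (N div 2)})"
  have cT: "card T = N div 2 + 1" by (auto simp: T_def)
  have TS: "T \<subseteq> sym_interval m N" by (auto simp: T_def sym_interval_eq split: if_splits)
  have ge: "ball_size 0 \<beta> m N \<le> 3 powr \<bar>\<beta>\<bar> * shifted_weight \<beta> k" if "k \<in> T" for k
  proof -
    define M where "M = N div 2"
    have "2 * int M \<le> int N" by (simp add: M_def)
    then have "\<bar>k\<bar> + 1 \<le> 3 * (\<bar>m\<bar> + int N + 1)" "\<bar>m\<bar> + int N + 1 \<le> 3 * (\<bar>k\<bar> + 1)"
      using that unfolding T_def M_def[symmetric] by (auto split: if_splits)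
    then have "real_of_int (\<bar>k\<bar> + 1) \<le> real_of_int (3 * (\<bar>m\<bar> + int N + 1))"
       "real_of_int (\<bar>m\<bar> + int N + 1) \<le> real_of_int (3 * (\<bar>k\<bar> + 1))"
      by (simp_all only: of_int_le_iff)
    then show ?thesis unfolding shifted_weight_def ball_size_def by (auto intro!: powr_le_of_comparable)
  qed
  have "N + 1 \<le> 2 * card T" unfolding cT by presburger
  then have cT2: "real N + 1 \<le> 2 * real (card T)" by linarith
  have "ball_size 1 \<beta> m N = (real N + 1) * ball_size 0 \<beta> m N" by (simp add: ball_size_def)
  also have "\<dots> \<le> 2 * real (card T) * ball_size 0 \<beta> m N"
    using cT2 by (intro mult_right_mono) auto
  also have "\<dots> = 2 * (\<Sum>k\<in>T. ball_size 0 \<beta> m N)" by simp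
  also have "\<dots> \<le> 2 * (\<Sum>k\<in>T. 3 powr \<bar>\<beta>\<bar> * shifted_weight \<beta> k)"
    by (intro mult_left_mono sum_mono ge) auto
  also have "\<dots> \<le> 2 * (\<Sum>k\<in>sym_interval m N. 3 powr \<bar>\<beta>\<bar> * shifted_weight \<beta> k)"
    by (intro mult_left_mono sum_mono2 TS) auto
  finally show ?thesis by (simp add: sum_distrib_left mult.assoc)
qed

lemma ball_size_mono:
  assumes "\<beta> > -1" "N \<le> N'"
  shows "ball_size 1 \<beta> m N \<le> ball_size 1 \<beta> m N'"
proof (cases "\<beta> \<ge> 0")
  case True
  then show ?thesis using assms unfolding ball_size_def by (intro mult_mono powr_mono2) auto
next
  case False
  \<comment> \<open>For negative \<open>\<beta>\<close> the second factor of
    \<open>ball_size\<close> decreases in the radius. This regrouping exhibits two nondecreasing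
    factors, the first because \<open>1 + \<beta> > 0\<close>.\<close>
  have eq: "ball_size 1 \<beta> m n = (real n + 1) powr (1 + \<beta>) * ((real n + 1) / (real_of_int \<bar>m\<bar> + real n + 1)) powr (-\<beta>)" for n
  proof -
    have "ball_size 1 \<beta> m n = (real n + 1) powr (1 + \<beta>) * ((real n + 1) powr (-\<beta>) * (real_of_int \<bar>m\<bar> + real n + 1) powr \<beta>)"
      unfolding ball_size_def by (simp add: powr_add[symmetric] mult.assoc[symmetric])
    also have "(real n + 1) powr (-\<beta>) * (real_of_int \<bar>m\<bar> + real n + 1) powr \<beta>
      = ((real n + 1) / (real_of_int \<bar>m\<bar> + real n + 1)) powr (-\<beta>)"
      by (subst powr_divide) (simp_all add: powr_minus field_simps)
    finally show ?thesis .
  qed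
  have "real_of_int \<bar>m\<bar> / (real_of_int \<bar>m\<bar> + real N' + 1) \<le> real_of_int \<bar>m\<bar> / (real_of_int \<bar>m\<bar> + real N + 1)"
    using assms by (intro divide_left_mono mult_pos_pos) (auto simp: add_nonneg_pos)
  moreover have "(real n + 1) / (real_of_int \<bar>m\<bar> + real n + 1) = 1 - real_of_int \<bar>m\<bar> / (real_of_int \<bar>m\<bar> + real n + 1)" for n
    using add_nonneg_pos[of "real_of_int \<bar>m\<bar> + real n" 1] by (subst eq_diff_eq, subst add_divide_distrib[symmetric]) (simp add: add_ac)
  ultimately have "(real N + 1) / (real_of_int \<bar>m\<bar> + real N + 1) \<le> (real N' + 1) / (real_of_int \<bar>m\<bar> + real N' + 1)"
    by simp
  then show ?thesis unfolding eq using assms False by (intro mult_mono powr_mono2) auto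
qed

subsection \<open>Boundedness of the maximal operator\<close>

definition mean :: "(int \<Rightarrow> real) \<Rightarrow> int \<Rightarrow> nat \<Rightarrow> real" where
  "mean x m N = (\<Sum>k\<in>sym_interval m N. x k) / (2 * real N + 1)"

text \<open>Here \<open>A\<close> corresponds to the \<open>p\<close>-th power of the Morrey norm.\<close>

definition morrey_bound :: "real \<Rightarrow> real \<Rightarrow> real \<Rightarrow> (int \<Rightarrow> real) \<Rightarrow> real \<Rightarrow> bool" where
  "morrey_bound p q \<beta> x A \<longleftrightarrow> (\<forall>k. 0 \<le> x k) \<and> 0 \<le> A \<and>
    (\<forall>m N. (\<Sum>k\<in>sym_interval m N. x k powr p * shifted_weight \<beta> k)
       \<le> A * ball_size (1 - p/q) (\<beta> * (1 - p/q)) m N)"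

lemma ball_size_0: "ball_size a 0 m N = (real N + 1) powr a"
  using add_nonneg_pos[of "real_of_int \<bar>m\<bar> + real N" 1] by (simp add: ball_size_def)

lemma ball_size_double:
  "ball_size a b m (2 * N) \<le> 2 powr \<bar>a\<bar> * 2 powr \<bar>b\<bar> * ball_size a b m N"
  "ball_size a b m N \<le> 2 powr \<bar>a\<bar> * 2 powr \<bar>b\<bar> * ball_size a b m (2 * N)"
proof -
  have 1: "real (2 * N) + 1 \<le> 2 * (real N + 1)" "real N + 1 \<le> 2 * (real (2 * N) + 1)"
    "real_of_int \<bar>m\<bar> + real (2 * N) + 1 \<le> 2 * (real_of_int \<bar>m\<bar> + real N + 1)"
    "real_of_int \<bar>m\<bar> + real N + 1 \<le> 2 * (real_of_int \<bar>m\<bar> + real (2 * N) + 1)"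
    "0 < real_of_int \<bar>m\<bar> + real (2 * N) + 1" "0 < real_of_int \<bar>m\<bar> + real N + 1"
    by (auto simp: add_nonneg_pos)
  have "ball_size a b m (2 * N) \<le> (2 powr \<bar>a\<bar> * (real N + 1) powr a) * (2 powr \<bar>b\<bar> * (real_of_int \<bar>m\<bar> + real N + 1) powr b)"
    unfolding ball_size_def using 1 by (intro mult_mono powr_le_of_comparable) auto
  then show "ball_size a b m (2 * N) \<le> 2 powr \<bar>a\<bar> * 2 powr \<bar>b\<bar> * ball_size a b m N"
    by (simp add: ball_size_def mult_ac)
  have "ball_size a b m N \<le> (2 powr \<bar>a\<bar> * (real (2 * N) + 1) powr a) * (2 powr \<bar>b\<bar> * (real_of_int \<bar>m\<bar> + real (2 * N) + 1) powr b)"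
    unfolding ball_size_def using 1 by (intro mult_mono powr_le_of_comparable) auto
  then show "ball_size a b m N \<le> 2 powr \<bar>a\<bar> * 2 powr \<bar>b\<bar> * ball_size a b m (2 * N)"
    by (simp add: ball_size_def mult_ac)
qed

lemma sum_powr_le_of_away:
  fixes x :: "int \<Rightarrow> real"
  assumes "2 * int N \<le> \<bar>m\<bar>"
  shows "ball_size 0 \<beta> m N * (\<Sum>k\<in>sym_interval m N. x k powr p)
    \<le> 3 powr \<bar>\<beta>\<bar> * (\<Sum>k\<in>sym_interval m N. x k powr p * shifted_weight \<beta> k)"
proof -
  have "ball_size 0 \<beta> m N * (\<Sum>k\<in>sym_interval m N. x k powr p)
     = (\<Sum>k\<in>sym_interval m N. x k powr p * ball_size 0 \<beta> m N)"
    by (simp add: sum_distrib_left mult.commute)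
  also have "\<dots> \<le> (\<Sum>k\<in>sym_interval m N. x k powr p * (3 powr \<bar>\<beta>\<bar> * shifted_weight \<beta> k))"
    using assms by (intro sum_mono mult_left_mono shifted_weight_away) auto
  finally show ?thesis by (simp add: sum_distrib_left mult_ac)
qed

text \<open>Away from the origin the weight is nearly constant and cancels, and Hoelder's inequality
  for counting measure passes from \<open>p\<close>-th powers to \<open>x\<close> itself. The
  extension to all balls requires \<open>1 - 1/q - \<beta>/q > 0\<close>, which is
  \<open>\<beta> < q - 1\<close>.\<close>

lemma sum_le_of_morrey_bound:
  assumes p: "1 < p" and pq: "p < q" and \<beta>: "\<beta> < q - 1"
  shows "\<exists>C>0. \<forall>x A m N. morrey_bound p q \<beta> x A \<longrightarrow>
    (\<Sum>k\<in>sym_interval m N. x k) \<le> C * A powr (1/p) * ball_size (1 - 1/q) (-\<beta>/q) m N"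
proof -
  have q: "q > 1" using p pq by simp
  have "(1 + \<beta>) / q < 1" using q \<beta> by simp
  then have "1 - 1/q \<ge> 0" "1 - 1/q + (-\<beta>/q) > 0" using q by (auto simp: add_divide_distrib)
  from sum_le_ball_size_of_away[OF this] obtain C where C: "C > 0" and 
    all: "\<forall>f B. (\<forall>k. f k \<ge> 0) \<longrightarrow> B \<ge> 0 \<longrightarrow>
    (\<forall>m N. 4 * int N \<le> \<bar>m\<bar> \<longrightarrow> (\<Sum>k\<in>sym_interval m N. f k) \<le> B * ball_size (1 - 1/q) (-\<beta>/q) m N) \<longrightarrow>
    (\<forall>m N. (\<Sum>k\<in>sym_interval m N. f k) \<le> C * B * ball_size (1 - 1/q) (-\<beta>/q) m N)" by auto
  define K where "K = (3 powr \<bar>\<beta>\<bar>) powr (1/p) * 2 powr (1 - 1/p)"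
  have K: "K > 0" by (simp add: K_def)
  have "(\<Sum>k\<in>sym_interval m N. x k) \<le> C * (K * A powr (1/p)) * ball_size (1 - 1/q) (-\<beta>/q) m N"
    if x: "morrey_bound p q \<beta> x A" for x A m N
  proof (intro all[rule_format])
    have x0: "0 \<le> x k" for k using x by (auto simp: morrey_bound_def)
    show "0 \<le> x k" for k by (rule x0)
    show "0 \<le> K * A powr (1/p)" using K by simp
    have A: "A \<ge> 0" using x by (simp add: morrey_bound_def)
    fix m N assume mN: "4 * int N \<le> \<bar>m\<bar>"
    define U where "U = (\<Sum>k\<in>sym_interval m N. x k powr p)"
    have U0: "U \<ge> 0" unfolding U_def by (intro sum_nonneg) auto
    have "ball_size 0 \<beta> m N * U \<le> 3 powr \<bar>\<beta>\<bar> * (\<Sum>k\<in>sym_interval m N. x k powr p * shifted_weight \<beta> k)"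
      unfolding U_def using mN by (intro sum_powr_le_of_away) auto
    also have "\<dots> \<le> 3 powr \<bar>\<beta>\<bar> * (A * ball_size (1 - p/q) (\<beta> * (1 - p/q)) m N)"
      using x by (intro mult_left_mono) (auto simp: morrey_bound_def)
    \<comment> \<open>Multiplication by the reciprocal of \<open>ball_size 0 \<beta> m N\<close>
      isolates \<open>U\<close>.\<close>
    finally have "ball_size 0 (-\<beta>) m N * (ball_size 0 \<beta> m N * U) \<le> ball_size 0 (-\<beta>) m N * (3 powr \<bar>\<beta>\<bar> * (A * ball_size (1 - p/q) (\<beta> * (1 - p/q)) m N))"
      by (intro mult_left_mono) auto
    also have "ball_size 0 (-\<beta>) m N * (ball_size 0 \<beta> m N * U) = U"
      by (simp add: mult.assoc[symmetric] ball_size_mult ball_size_0)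
    also have "ball_size 0 (-\<beta>) m N * (3 powr \<bar>\<beta>\<bar> * (A * ball_size (1 - p/q) (\<beta> * (1 - p/q)) m N))
      = 3 powr \<bar>\<beta>\<bar> * (A * (ball_size 0 (-\<beta>) m N * ball_size (1 - p/q) (\<beta> * (1 - p/q)) m N))"
      by (simp only: mult_ac)
    also have "ball_size 0 (-\<beta>) m N * ball_size (1 - p/q) (\<beta> * (1 - p/q)) m N = ball_size (1 - p/q) (-\<beta> * p/q) m N"
      unfolding ball_size_mult by (simp add: algebra_simps)
    finally have U: "U \<le> 3 powr \<bar>\<beta>\<bar> * (A * ball_size (1 - p/q) (-\<beta> * p/q) m N)" .
    have "(\<Sum>k\<in>sym_interval m N. x k) \<le> U powr (1/p) * (2 * real N + 1) powr (1 - 1/p)"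
      using weighted_Hoelder_sum[of "sym_interval m N" p x "\<lambda>_. 1"] p x0 
      by (simp add: U_def card_sym_interval add_ac)
    also have "\<dots> \<le> (3 powr \<bar>\<beta>\<bar> * (A * ball_size (1 - p/q) (-\<beta> * p/q) m N)) powr (1/p) * (2 * (real N + 1)) powr (1 - 1/p)"
      using p U U0 by (intro mult_mono powr_mono2) auto
    also have "\<dots> = K * A powr (1/p) * (ball_size (1 - p/q) (-\<beta> * p/q) m N powr (1/p) * ball_size (1 - 1/p) 0 m N)"
    proof -
      have "(2 * (real N + 1)) powr (1 - 1/p) = 2 powr (1 - 1/p) * (real N + 1) powr (1 - 1/p)"
        by (rule powr_mult)
      moreover have "(3 powr \<bar>\<beta>\<bar> * (A * ball_size (1 - p/q) (-\<beta> * p/q) m N)) powr (1/p)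
        = (3 powr \<bar>\<beta>\<bar>) powr (1/p) * (A powr (1/p) * ball_size (1 - p/q) (-\<beta> * p/q) m N powr (1/p))"
        using A by (simp add: powr_mult)
      ultimately show ?thesis by (simp only: K_def ball_size_0 mult_ac)
    qed
    also have "ball_size (1 - p/q) (-\<beta> * p/q) m N powr (1/p) * ball_size (1 - 1/p) 0 m N = ball_size (1 - 1/q) (-\<beta>/q) m N"
      unfolding ball_size_powr ball_size_mult using p by (simp add: diff_divide_distrib)
    finally show "(\<Sum>k\<in>sym_interval m N. x k) \<le> K * A powr (1/p) * ball_size (1 - 1/q) (-\<beta>/q) m N" .
  qed
  then show ?thesis using C K by (intro exI[of _ "C * K"]) (auto simp: mult.assoc)
qed

text \<open>The bound at radius \<open>n\<close> is a multiple of
  \<open>ball_size 1 \<beta> m (2 * n) powr (-1/q)\<close>. As the exponent is negative,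
  \<open>ball_size_mono\<close> replaces \<open>2 * n\<close> by any \<open>N \<le> n\<close>. The
  centre \<open>k\<close> may move near \<open>m\<close>, so one bound serves all points of a
  ball.\<close>

lemma mean_le_of_morrey_bound:
  assumes p: "1 < p" and pq: "p < q" and \<beta>: "-1 < \<beta>" "\<beta> < q - 1"
  shows "\<exists>C>0. \<forall>x A m k n N. morrey_bound p q \<beta> x A \<longrightarrow> sym_interval k n \<subseteq> sym_interval m (2 * n) \<longrightarrow> N \<le> n \<longrightarrow>
    mean x k n \<le> C * A powr (1/p) * ball_size (-1/q) (-\<beta>/q) m N"
proof -
  have q: "q > 1" using p pq by simp
  obtain C where C: "C > 0" and bd: "\<forall>x A m N. morrey_bound p q \<beta> x A \<longrightarrow>
    (\<Sum>k\<in>sym_interval m N. x k) \<le> C * A powr (1/p) * ball_size (1 - 1/q) (-\<beta>/q) m N"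
    using sum_le_of_morrey_bound[OF p pq \<beta>(2)] by auto
  have "mean x k n \<le> C * A powr (1/p) * ball_size (-1/q) (-\<beta>/q) m N"
    if x: "morrey_bound p q \<beta> x A" and sub: "sym_interval k n \<subseteq> sym_interval m (2 * n)" and n: "N \<le> n" for x A m k n N
  proof -
    have x0: "0 \<le> x k" for k using x by (auto simp: morrey_bound_def)
    have "(\<Sum>j\<in>sym_interval k n. x j) \<le> (\<Sum>j\<in>sym_interval m (2 * n). x j)"
      using sub x0 by (intro sum_mono2) auto
    also have "\<dots> \<le> C * A powr (1/p) * ball_size (1 - 1/q) (-\<beta>/q) m (2 * n)"
      using bd x by blast
    also have "\<dots> = C * A powr (1/p) * ball_size (-1/q) (-\<beta>/q) m (2 * n) * (2 * real n + 1)"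
    proof -
      have "ball_size 1 0 m (2 * n) = 2 * real n + 1" by (simp add: ball_size_0)
      then show ?thesis using ball_size_mult[of "-1/q" "-\<beta>/q" m "2 * n" 1 0] by simp
    qed
    finally have "mean x k n \<le> C * A powr (1/p) * ball_size (-1/q) (-\<beta>/q) m (2 * n)"
      by (simp add: mean_def divide_le_eq)
    also have "ball_size (-1/q) (-\<beta>/q) m (2 * n) = ball_size 1 \<beta> m (2 * n) powr (-1/q)"
      by (simp add: ball_size_powr)
    also have "\<dots> \<le> ball_size 1 \<beta> m N powr (-1/q)"
      using n q \<beta> by (intro powr_mono2' ball_size_mono) auto
    also have "\<dots> = ball_size (-1/q) (-\<beta>/q) m N"
      by (simp add: ball_size_powr)
    finally show ?thesis using C by (auto simp: mult_left_mono)
  qed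
  then show ?thesis using C by blast
qed

section \<open>Averages over small balls inside a fixed interval\<close>

lemma sum_int_interval:
  assumes "a \<le> b"
  shows "(\<Sum>k\<in>{a..b}. f k) = (\<Sum>i\<le>nat (b - a). f (a + int i))"
    and "(\<Sum>k\<in>{a..b}. f k) = (\<Sum>i\<le>nat (b - a). f (b - int i))"
proof -
  show "(\<Sum>k\<in>{a..b}. f k) = (\<Sum>i\<le>nat (b - a). f (a + int i))"
    using assms by (intro sum.reindex_bij_witness[of _ "\<lambda>i. a + int i" "\<lambda>k. nat (k - a)"]) auto
  show "(\<Sum>k\<in>{a..b}. f k) = (\<Sum>i\<le>nat (b - a). f (b - int i))"
    using assms by (intro sum.reindex_bij_witness[of _ "\<lambda>i. b - int i" "\<lambda>k. nat (b - k)"]) auto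
qed

text \<open>A ball around \<open>k\<close> is the union of a window ending at \<open>k\<close> and a
  window starting at \<open>k\<close>; reflecting the interval turns the second kind into the first.
  The function \<open>g\<close> is the sum of the two one-sided maximal functions.\<close>

lemma local_maximal_lp_bound:
  assumes p: "p > (1::real)"
  shows "\<exists>C>0. \<forall>x a b. (\<forall>k. x k \<ge> 0) \<longrightarrow> (\<exists>g. (\<forall>k. g k \<ge> 0) \<and>
     (\<forall>k n. sym_interval k n \<subseteq> {a..b} \<longrightarrow> mean x k n \<le> g k) \<and>
     (\<Sum>k\<in>{a..b}. g k powr p) \<le> C * (\<Sum>k\<in>{a..b}. x k powr p))"
proof -
  obtain C where C: "C > 0" and lm: "\<And>f n. (\<forall>i. f i \<ge> 0) \<Longrightarrow> (\<Sum>i\<le>n. left_max f i powr p) \<le> C * (\<Sum>i\<le>n. f i powr p)"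
    using left_max_lp_bound[OF p] by blast
  have "\<exists>g. (\<forall>k. g k \<ge> 0) \<and>
     (\<forall>k n. sym_interval k n \<subseteq> {a..b} \<longrightarrow> mean x k n \<le> g k) \<and>
     (\<Sum>k\<in>{a..b}. g k powr p) \<le> 2 powr p * 2 * C * (\<Sum>k\<in>{a..b}. x k powr p)"
    if x: "\<forall>k. x k \<ge> 0" for x a b
  proof -
    \<comment> \<open>The interval is read from its left end by \<open>u\<close> and from its right
      end by \<open>w\<close>.\<close>
    define u where "u = (\<lambda>i. x (a + int i))"
    define w where "w = (\<lambda>i. x (b - int i))"
    define L where "L = (\<lambda>k. left_max u (nat (k - a)))"
    define M where "M = (\<lambda>k. left_max w (nat (b - k)))"
    have L0: "L k \<ge> 0" and M0: "M k \<ge> 0" for k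
      unfolding L_def M_def u_def w_def using x by (auto intro: left_max_nonneg)
    show ?thesis
    proof (intro exI[of _ "\<lambda>k. L k + M k"] conjI allI impI)
      show "0 \<le> L k + M k" for k using L0 M0 by (simp add: add_nonneg_nonneg)
    next
      fix k n assume "sym_interval k n \<subseteq> {a..b}"
      then have sub: "a \<le> k - int n" "k + int n \<le> b" by (auto simp: sym_interval_eq)
      have "(\<Sum>j\<in>{k - int n..k}. x j) / (real n + 1) = average u (nat (k - a) - n) (nat (k - a))"
      proof -
        have "(\<Sum>j\<in>{k - int n..k}. x j) = (\<Sum>i=nat (k - a) - n..nat (k - a). u i)"
          using sub unfolding u_def
          by (intro sum.reindex_bij_witness[of _ "\<lambda>i. a + int i" "\<lambda>k. nat (k - a)"]) auto
        moreover have "Suc (nat (k - a)) - (nat (k - a) - n) = n + 1" using sub by auto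
        ultimately show ?thesis by (simp add: average_def add_ac)
      qed
      also have "\<dots> \<le> L k" unfolding L_def by (rule average_le_left_max) auto
      finally have 1: "(\<Sum>j\<in>{k - int n..k}. x j) \<le> L k * (real n + 1)" by (simp add: divide_le_eq)
      have "(\<Sum>j\<in>{k..k + int n}. x j) / (real n + 1) = average w (nat (b - k) - n) (nat (b - k))"
      proof -
        have "(\<Sum>j\<in>{k..k + int n}. x j) = (\<Sum>i=nat (b - k) - n..nat (b - k). w i)"
          using sub unfolding w_def
          by (intro sum.reindex_bij_witness[of _ "\<lambda>i. b - int i" "\<lambda>k. nat (b - k)"]) auto
        moreover have "Suc (nat (b - k)) - (nat (b - k) - n) = n + 1" using sub by auto
        ultimately show ?thesis by (simp add: average_def add_ac)
      qed
      also have "\<dots> \<le> M k" unfolding M_def by (rule average_le_left_max) auto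
      finally have 2: "(\<Sum>j\<in>{k..k + int n}. x j) \<le> M k * (real n + 1)" by (simp add: divide_le_eq)
      have "sym_interval k n = {k - int n..k} \<union> {k..k + int n}" by (auto simp: sym_interval_eq)
      \<comment> \<open>The point \<open>k\<close> lies in both windows, so the estimate relies on
        \<open>x\<close> being nonnegative.\<close>
      then have "(\<Sum>j\<in>sym_interval k n. x j) \<le> (\<Sum>j\<in>{k - int n..k}. x j) + (\<Sum>j\<in>{k..k + int n}. x j)"
        using x by (simp add: sum_Un sum_nonneg)
      also have "\<dots> \<le> (L k + M k) * (real n + 1)" using 1 2 by (simp add: algebra_simps)
      also have "\<dots> \<le> (L k + M k) * (2 * real n + 1)" using L0[of k] M0[of k] by (intro mult_left_mono) auto
      finally show "mean x k n \<le> L k + M k" by (simp add: mean_def divide_le_eq)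
    next
      show "(\<Sum>k\<in>{a..b}. (L k + M k) powr p) \<le> 2 powr p * 2 * C * (\<Sum>k\<in>{a..b}. x k powr p)"
      proof (cases "a \<le> b")
        case True
        have "(\<Sum>k\<in>{a..b}. L k powr p) \<le> C * (\<Sum>k\<in>{a..b}. x k powr p)"
          unfolding sum_int_interval(1)[OF True] L_def using lm[of u "nat (b - a)"] x by (simp add: u_def)
        moreover have "(\<Sum>k\<in>{a..b}. M k powr p) \<le> C * (\<Sum>k\<in>{a..b}. x k powr p)"
          unfolding sum_int_interval(2)[OF True] M_def using lm[of w "nat (b - a)"] x by (simp add: w_def)
        moreover have "(\<Sum>k\<in>{a..b}. (L k + M k) powr p) \<le> (\<Sum>k\<in>{a..b}. 2 powr p * (L k powr p + M k powr p))"
          using L0 M0 p by (intro sum_mono add_powr_le) auto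
        ultimately have "(\<Sum>k\<in>{a..b}. (L k + M k) powr p) \<le> 2 powr p * (C * (\<Sum>k\<in>{a..b}. x k powr p) + C * (\<Sum>k\<in>{a..b}. x k powr p))"
          by (auto simp: sum_distrib_left[symmetric] sum.distrib elim!: order_trans intro!: mult_left_mono add_mono)
        then show ?thesis by simp
      qed simp
    qed
  qed
  then show ?thesis using C by (intro exI[of _ "2 powr p * 2 * C"]) auto
qed

lemma mean_nonneg: "(\<And>k. 0 \<le> x k) \<Longrightarrow> 0 \<le> mean x k n"
  by (simp add: mean_def sum_nonneg)

text \<open>The choice \<open>m = k\<close> and \<open>N = 0\<close> covers all radii at once; this
  is what makes the maximal function finite.\<close>

lemma mean_bounded_of_morrey_bound:
  assumes p: "1 < p" and pq: "p < q" and \<beta>: "-1 < \<beta>" "\<beta> < q - 1"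
    and x: "morrey_bound p q \<beta> x A"
  shows "bdd_above (range (mean x k))"
proof -
  obtain C where C: "C > 0" and bd: "\<forall>x A m k n N. morrey_bound p q \<beta> x A \<longrightarrow> sym_interval k n \<subseteq> sym_interval m (2 * n) \<longrightarrow> N \<le> n \<longrightarrow>
    mean x k n \<le> C * A powr (1/p) * ball_size (-1/q) (-\<beta>/q) m N"
    using mean_le_of_morrey_bound[OF p pq \<beta>] by auto
  have "mean x k n \<le> C * A powr (1/p) * ball_size (-1/q) (-\<beta>/q) k 0" for n
    using x by (intro bd[rule_format] sym_interval_mono) auto
  then show ?thesis by (auto intro!: bdd_aboveI)
qed

text \<open>On a ball of radius \<open>N\<close> away from the origin, averages of radius at most
  \<open>N\<close> stay in the doubled ball and fall under the local \<open>l^p\<close> bound, while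
  larger ones are bounded by a constant. Only the least-upper-bound property of the maximal function
  enters, so \<open>y\<close> is described by it.\<close>

lemma morrey_bound_maximal:
  assumes p: "1 < p" and pq: "p < q" and \<beta>: "-1 < \<beta>" "\<beta> < q - 1"
  shows "\<exists>C>0. \<forall>x A y. morrey_bound p q \<beta> x A \<longrightarrow>
    (\<forall>k. 0 \<le> y k \<and> (\<forall>B. (\<forall>n. mean x k n \<le> B) \<longrightarrow> y k \<le> B)) \<longrightarrow> morrey_bound p q \<beta> y (C * A)"
proof -
  define \<theta> where "\<theta> = 1 - p/q"
  have \<theta>: "0 < \<theta>" using p pq by (simp add: \<theta>_def)
  have "\<theta> + \<beta> * \<theta> = (1 + \<beta>) * \<theta>" by (simp add: algebra_simps)
  then have "\<theta> \<ge> 0" "\<theta> + \<beta> * \<theta> > 0" using \<theta> \<beta> by auto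
  from sum_le_ball_size_of_away[OF this] obtain C0 where C0: "C0 > 0" and 
    all: "\<forall>f B. (\<forall>k. f k \<ge> 0) \<longrightarrow> B \<ge> 0 \<longrightarrow>
    (\<forall>m N. 4 * int N \<le> \<bar>m\<bar> \<longrightarrow> (\<Sum>k\<in>sym_interval m N. f k) \<le> B * ball_size \<theta> (\<beta> * \<theta>) m N) \<longrightarrow>
    (\<forall>m N. (\<Sum>k\<in>sym_interval m N. f k) \<le> C0 * B * ball_size \<theta> (\<beta> * \<theta>) m N)" by auto
  obtain C1 where C1: "C1 > 0" and bd: "\<forall>x A m k n N. morrey_bound p q \<beta> x A \<longrightarrow> sym_interval k n \<subseteq> sym_interval m (2 * n) \<longrightarrow> N \<le> n \<longrightarrow>
    mean x k n \<le> C1 * A powr (1/p) * ball_size (-1/q) (-\<beta>/q) m N"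
    using mean_le_of_morrey_bound[OF p pq \<beta>] by auto
  obtain C2 where C2: "C2 > 0" and lm: "\<forall>x a b. (\<forall>k. x k \<ge> 0) \<longrightarrow> (\<exists>g. (\<forall>k. g k \<ge> 0) \<and>
     (\<forall>k n. sym_interval k n \<subseteq> {a..b} \<longrightarrow> mean x k n \<le> g k) \<and>
     (\<Sum>k\<in>{a..b}. g k powr p) \<le> C2 * (\<Sum>k\<in>{a..b}. x k powr p))"
    using local_maximal_lp_bound[OF p] by auto
  \<comment> \<open>\<open>E\<close> collects the losses of the local part: doubling of the weight,
    removal of the weight, and doubling of the target bound. \<open>K\<close> then adds the return
    to the weight and the splitting of a \<open>p\<close>-th power of a sum.\<close>
  define E where "E = 2 powr \<bar>\<beta>\<bar> * 3 powr \<bar>\<beta>\<bar> * (2 powr \<theta> * 2 powr \<bar>\<beta> * \<theta>\<bar>)"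
  define K where "K = 3 powr \<bar>\<beta>\<bar> * 2 powr p * (C2 * E + 2 * C1 powr p)"
  have E: "E > 0" by (simp add: E_def)
  have K: "K > 0" using C1 C2 E unfolding K_def by (intro mult_pos_pos add_pos_pos) auto
  have "morrey_bound p q \<beta> y (C0 * K * A)"
    if x: "morrey_bound p q \<beta> x A" and y: "\<forall>k. 0 \<le> y k \<and> (\<forall>B. (\<forall>n. mean x k n \<le> B) \<longrightarrow> y k \<le> B)" for x A y
  proof -
    have x0: "0 \<le> x k" for k using x by (auto simp: morrey_bound_def)
    have A: "A \<ge> 0" using x by (simp add: morrey_bound_def)
    have "(\<Sum>k\<in>sym_interval m N. y k powr p * shifted_weight \<beta> k) \<le> C0 * (K * A) * ball_size \<theta> (\<beta> * \<theta>) m N" for m N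
    proof (intro all[rule_format])
      fix m N assume mN: "4 * int N \<le> \<bar>m\<bar>"
      let ?S = "sym_interval m N" and ?S' = "sym_interval m (2 * N)"
      let ?D = "ball_size 0 \<beta> m N" and ?W = "ball_size \<theta> (\<beta> * \<theta>) m N"
      define F where "F = C1 * A powr (1/p) * ball_size (-1/q) (-\<beta>/q) m N"
      have F: "F \<ge> 0" using C1 by (simp add: F_def)
      obtain g where g: "\<forall>k. g k \<ge> 0" and gm: "\<forall>k n. sym_interval k n \<subseteq> ?S' \<longrightarrow> mean x k n \<le> g k"
        and gs: "(\<Sum>k\<in>?S'. g k powr p) \<le> C2 * (\<Sum>k\<in>?S'. x k powr p)"
        using lm x0 unfolding sym_interval_eq[of m "2 * N"] by blast
      have yk: "y k powr p \<le> 2 powr p * (g k powr p + F powr p)" if k: "k \<in> ?S" for k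
      proof -
        have km: "\<bar>k - m\<bar> \<le> int N" using k by (simp add: sym_interval_def)
        have "mean x k n \<le> g k + F" for n
        proof (cases "n \<le> N")
          case True
          then have "mean x k n \<le> g k" using km by (intro gm[rule_format] sym_interval_mono) auto
          then show ?thesis using F by simp
        next
          case False
          then have "mean x k n \<le> F" unfolding F_def using x km
            by (intro bd[rule_format] sym_interval_mono) auto
          then show ?thesis using g by (simp add: add_increasing)
        qed
        then have "y k \<le> g k + F" using y by blast
        then have "y k powr p \<le> (g k + F) powr p" using y p by (intro powr_mono2) auto
        also have "\<dots> \<le> 2 powr p * (g k powr p + F powr p)" using g F p by (intro add_powr_le) auto
        finally show ?thesis .
      qed
      have local: "?D * (\<Sum>k\<in>?S. g k powr p) \<le> C2 * E * A * ?W"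
      proof -
        have "(\<Sum>k\<in>?S. g k powr p) \<le> (\<Sum>k\<in>?S'. g k powr p)"
          by (intro sum_mono2 sym_interval_mono) auto
        also note gs
        finally have "?D * (\<Sum>k\<in>?S. g k powr p) \<le> (2 powr \<bar>\<beta>\<bar> * ball_size 0 \<beta> m (2 * N)) * (C2 * (\<Sum>k\<in>?S'. x k powr p))"
          using ball_size_double(2)[of 0 \<beta> m N] by (intro mult_mono) (auto intro!: sum_nonneg)
        also have "\<dots> = C2 * 2 powr \<bar>\<beta>\<bar> * (ball_size 0 \<beta> m (2 * N) * (\<Sum>k\<in>?S'. x k powr p))"
          by simp
        \<comment> \<open>The hypothesis \<open>4 * N \<le> |m|\<close> keeps the weight nearly
          constant even on the doubled ball.\<close>
        also have "\<dots> \<le> C2 * 2 powr \<bar>\<beta>\<bar> * (3 powr \<bar>\<beta>\<bar> * (\<Sum>k\<in>?S'. x k powr p * shifted_weight \<beta> k))"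
          using mN C2 by (intro mult_left_mono sum_powr_le_of_away) auto
        also have "\<dots> \<le> C2 * 2 powr \<bar>\<beta>\<bar> * (3 powr \<bar>\<beta>\<bar> * (A * ball_size \<theta> (\<beta> * \<theta>) m (2 * N)))"
          using x C2 by (intro mult_left_mono) (auto simp: morrey_bound_def \<theta>_def)
        also have "\<dots> \<le> C2 * 2 powr \<bar>\<beta>\<bar> * (3 powr \<bar>\<beta>\<bar> * (A * (2 powr \<bar>\<theta>\<bar> * 2 powr \<bar>\<beta> * \<theta>\<bar> * ?W)))"
          using C2 A by (intro mult_left_mono ball_size_double) auto
        also have "\<dots> = C2 * E * A * ?W" using \<theta> by (simp add: E_def)
        finally show ?thesis .
      qed
      have Fp: "F powr p = C1 powr p * A * ball_size (-p/q) (-\<beta> * p/q) m N"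
        unfolding F_def using C1 A p by (simp add: powr_mult powr_powr ball_size_powr)
      have far: "?D * ((2 * real N + 1) * F powr p) \<le> 2 * C1 powr p * A * ?W"
      proof -
        have "?D * ((2 * real N + 1) * F powr p) \<le> ?D * ((2 * ball_size 1 0 m N) * F powr p)"
          by (intro mult_left_mono mult_right_mono) (auto simp: ball_size_0)
        also have "\<dots> = 2 * C1 powr p * A * ((?D * ball_size 1 0 m N) * ball_size (-p/q) (-\<beta> * p/q) m N)"
          by (simp add: Fp)
        also have "(?D * ball_size 1 0 m N) * ball_size (-p/q) (-\<beta> * p/q) m N = ?W"
          unfolding ball_size_mult by (simp add: \<theta>_def algebra_simps)
        finally show ?thesis .
      qed
      have "(\<Sum>k\<in>?S. y k powr p * shifted_weight \<beta> k) \<le> (\<Sum>k\<in>?S. (2 powr p * (g k powr p + F powr p)) * (3 powr \<bar>\<beta>\<bar> * ?D))"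
        using mN by (intro sum_mono mult_mono yk shifted_weight_away) auto
      also have "\<dots> = 3 powr \<bar>\<beta>\<bar> * 2 powr p * (?D * (\<Sum>k\<in>?S. g k powr p) + ?D * ((2 * real N + 1) * F powr p))"
        by (simp add: sum_distrib_left[symmetric] sum_distrib_right[symmetric] sum.distrib card_sym_interval algebra_simps)
      also have "\<dots> \<le> 3 powr \<bar>\<beta>\<bar> * 2 powr p * (C2 * E * A * ?W + 2 * C1 powr p * A * ?W)"
        by (intro mult_left_mono add_mono local far) auto
      also have "\<dots> = K * A * ?W" by (simp add: K_def algebra_simps)
      finally show "(\<Sum>k\<in>?S. y k powr p * shifted_weight \<beta> k) \<le> K * A * ?W" .
    qed (use K A in auto)
    then show ?thesis unfolding morrey_bound_def using y C0 K A by (auto simp: \<theta>_def mult.assoc)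
  qed
  then show ?thesis using C0 K by (intro exI[of _ "C0 * K"]) auto
qed

lemma power_weight_pos [simp]: "0 < power_weight \<beta> k"
  by (simp add: power_weight_def)

lemma power_weight_nonneg [simp]: "0 \<le> power_weight \<beta> k"
  by (simp add: less_imp_le)

lemma power_weight_comparable:
  "shifted_weight \<beta> k \<le> 2 powr \<bar>\<beta>\<bar> * power_weight \<beta> k"
  "power_weight \<beta> k \<le> 2 powr \<bar>\<beta>\<bar> * shifted_weight \<beta> k"
proof -
  have one: "1 \<le> (2::real) powr \<bar>\<beta>\<bar>" by (rule ge_one_powr_ge_zero) auto
  have "1 \<le> real_of_int \<bar>k\<bar>" if "k \<noteq> 0" using that by linarith
  then show "shifted_weight \<beta> k \<le> 2 powr \<bar>\<beta>\<bar> * power_weight \<beta> k"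
    "power_weight \<beta> k \<le> 2 powr \<bar>\<beta>\<bar> * shifted_weight \<beta> k"
    using one unfolding shifted_weight_def power_weight_def
    by (auto intro!: powr_le_of_comparable)
qed

lemma sum_sym_interval_pos:
  fixes \<omega> :: "int \<Rightarrow> real"
  assumes "\<And>k. 0 < \<omega> k"
  shows "0 < (\<Sum>k\<in>sym_interval m N. \<omega> k)"
  using assms by (intro sum_pos2[of _ m]) (auto simp: less_imp_le)

lemma morrey_norm_le_iff:
  assumes w: "\<And>k. 0 < \<omega> k" and p: "p > 0" and q: "q > 0" and A: "A \<ge> 0"
  shows "morrey_norm \<omega> p q x \<le> ereal A \<longleftrightarrow>
    (\<forall>m N. (\<Sum>k\<in>sym_interval m N. \<bar>x k\<bar> powr p * \<omega> k)
       \<le> A powr p * (\<Sum>k\<in>sym_interval m N. \<omega> k) powr (1 - p/q))"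
proof -
  have *: "V powr (1/q - 1/p) * U powr (1/p) \<le> A \<longleftrightarrow> U \<le> A powr p * V powr (1 - p/q)"
    if U: "U \<ge> 0" and V: "V > 0" for U V
  proof -
    let ?L = "V powr (1/q - 1/p) * U powr (1/p)"
    have "?L \<le> A \<longleftrightarrow> ?L powr p \<le> A powr p"
      using A p powr_mono2[of p ?L A] powr_less_mono2[of p A ?L] by (auto simp: not_le[symmetric])
    also have "?L powr p = V powr (p/q - 1) * U"
      using U V p by (simp add: powr_mult powr_powr left_diff_distrib)
    also have "V powr (p/q - 1) * U = U / V powr (1 - p/q)"
      using powr_minus[of V "1 - p/q"] by (simp add: field_simps)
    also have "U / V powr (1 - p/q) \<le> A powr p \<longleftrightarrow> U \<le> A powr p * V powr (1 - p/q)"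
      using V by (simp add: divide_le_eq)
    finally show ?thesis .
  qed
  have "morrey_norm \<omega> p q x \<le> ereal A \<longleftrightarrow> (\<forall>m N.
     (\<Sum>k\<in>sym_interval m N. \<omega> k) powr (1/q - 1/p) * (\<Sum>k\<in>sym_interval m N. \<bar>x k\<bar> powr p * \<omega> k) powr (1/p) \<le> A)"
    by (auto simp: morrey_norm_def SUP_le_iff)
  also have "\<dots> \<longleftrightarrow> (\<forall>m N. (\<Sum>k\<in>sym_interval m N. \<bar>x k\<bar> powr p * \<omega> k)
       \<le> A powr p * (\<Sum>k\<in>sym_interval m N. \<omega> k) powr (1 - p/q))"
  proof (intro all_cong1 *)
    fix m N
    show "0 \<le> (\<Sum>k\<in>sym_interval m N. \<bar>x k\<bar> powr p * \<omega> k)"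
      using w by (intro sum_nonneg) (auto simp: less_imp_le)
    show "0 < (\<Sum>k\<in>sym_interval m N. \<omega> k)"
      by (intro sum_sym_interval_pos w)
  qed
  finally show ?thesis .
qed

lemma morrey_norm_nonneg: "0 \<le> morrey_norm \<omega> p q x"
  unfolding morrey_norm_def by (rule SUP_upper2[of "(0, 0)"]) auto

lemma maximal_op_eq_mean: "maximal_op x m = (SUP N. ereal (mean (\<lambda>k. \<bar>x k\<bar>) m N))"
  by (simp add: maximal_op_def mean_def card_sym_interval add_ac)

lemma maximal_op_eq_ereal:
  assumes "bdd_above (range (mean (\<lambda>k. \<bar>x k\<bar>) m))"
  shows "maximal_op x m = ereal (SUP N. mean (\<lambda>k. \<bar>x k\<bar>) m N)"
proof -
  let ?M = "mean (\<lambda>k. \<bar>x k\<bar>) m"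
  have "(SUP N. ereal (?M N)) \<le> ereal (SUP N. ?M N)"
    using assms by (intro SUP_least) (auto intro: cSUP_upper)
  moreover have "ereal (?M 0) \<le> (SUP N. ereal (?M N))" by (intro SUP_upper) auto
  ultimately have "\<bar>SUP N. ereal (?M N)\<bar> \<noteq> \<infinity>" by auto
  then show ?thesis unfolding maximal_op_eq_mean by (rule ereal_SUP[symmetric])
qed

lemma maximal_op_bounded_if:
  assumes p: "1 < p" and pq: "p < q" and \<beta>: "-1 < \<beta>" "\<beta> < q - 1"
  shows "maximal_op_bounded_on_morrey (power_weight \<beta>) p q"
proof -
  let ?w = "power_weight \<beta>"
  define \<theta> where "\<theta> = 1 - p/q"
  have q: "q > 0" using p pq by simp
  have \<theta>: "0 < \<theta>" using p pq by (simp add: \<theta>_def)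
  obtain C1 where C1: "C1 > 0" and upper: "\<forall>m N. (\<Sum>k\<in>sym_interval m N. shifted_weight \<beta> k) \<le> C1 * ball_size 1 \<beta> m N"
    using sum_shifted_weight_le[OF \<beta>(1)] by auto
  obtain C2 where C2: "C2 > 0" and maximal: "\<forall>x A y. morrey_bound p q \<beta> x A \<longrightarrow>
    (\<forall>k. 0 \<le> y k \<and> (\<forall>B. (\<forall>n. mean x k n \<le> B) \<longrightarrow> y k \<le> B)) \<longrightarrow> morrey_bound p q \<beta> y (C2 * A)"
    using morrey_bound_maximal[OF p pq \<beta>] by auto
  define D where "D = (2::real) powr \<bar>\<beta>\<bar>"
  define E where "E = 2 * 3 powr \<bar>\<beta>\<bar> * D"
  define K where "K = D * E powr \<theta> * (C2 * (D * (D * C1) powr \<theta>))"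
  have D: "D > 0" by (simp add: D_def)
  have E: "E > 0" using D by (simp add: E_def)
  have K: "K > 0" using C1 C2 D E by (simp add: K_def)
  have W: "ball_size \<theta> (\<beta> * \<theta>) m N = ball_size 1 \<beta> m N powr \<theta>" for m N
    by (simp add: ball_size_powr)
  have wup: "(\<Sum>k\<in>sym_interval m N. ?w k) \<le> D * C1 * ball_size 1 \<beta> m N" for m N
  proof -
    have "(\<Sum>k\<in>sym_interval m N. ?w k) \<le> (\<Sum>k\<in>sym_interval m N. D * shifted_weight \<beta> k)"
      unfolding D_def by (intro sum_mono power_weight_comparable)
    also have "\<dots> = D * (\<Sum>k\<in>sym_interval m N. shifted_weight \<beta> k)" by (simp add: sum_distrib_left)
    also have "\<dots> \<le> D * (C1 * ball_size 1 \<beta> m N)" using upper D by (intro mult_left_mono) auto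
    finally show ?thesis by simp
  qed
  have wlow: "ball_size 1 \<beta> m N \<le> E * (\<Sum>k\<in>sym_interval m N. ?w k)" for m N
  proof -
    have "ball_size 1 \<beta> m N \<le> 2 * 3 powr \<bar>\<beta>\<bar> * (\<Sum>k\<in>sym_interval m N. shifted_weight \<beta> k)"
      by (rule sum_shifted_weight_ge)
    also have "\<dots> \<le> 2 * 3 powr \<bar>\<beta>\<bar> * (\<Sum>k\<in>sym_interval m N. D * ?w k)"
      unfolding D_def by (intro mult_left_mono sum_mono power_weight_comparable) auto
    also have "\<dots> = E * (\<Sum>k\<in>sym_interval m N. ?w k)"
      unfolding sum_distrib_left[symmetric] by (simp add: E_def)
    finally show ?thesis .
  qed
  have main: "(\<forall>m. maximal_op x m = ereal (y m)) \<and> morrey_norm ?w p q y \<le> ereal (K powr (1/p) * A)"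
    if x: "morrey_norm ?w p q x \<le> ereal A" and A: "A \<ge> 0" and y_def: "y = (\<lambda>m. SUP N. mean (\<lambda>k. \<bar>x k\<bar>) m N)" for x y A
  proof -
    define B where "B = D * (D * C1) powr \<theta> * A powr p"
    have mb: "morrey_bound p q \<beta> (\<lambda>k. \<bar>x k\<bar>) B"
      unfolding morrey_bound_def \<theta>_def[symmetric]
    proof (intro conjI allI)
      show "0 \<le> B" using D by (simp add: B_def)
      fix m N
      have "(\<Sum>k\<in>sym_interval m N. \<bar>x k\<bar> powr p * shifted_weight \<beta> k) \<le> (\<Sum>k\<in>sym_interval m N. \<bar>x k\<bar> powr p * (D * ?w k))"
        unfolding D_def by (intro sum_mono mult_left_mono power_weight_comparable) auto
      also have "\<dots> = D * (\<Sum>k\<in>sym_interval m N. \<bar>x k\<bar> powr p * ?w k)"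
        by (simp add: sum_distrib_left mult_ac)
      also have "\<dots> \<le> D * (A powr p * (\<Sum>k\<in>sym_interval m N. ?w k) powr \<theta>)"
        using x D p q A by (intro mult_left_mono) (auto simp: morrey_norm_le_iff \<theta>_def)
      also have "\<dots> \<le> D * (A powr p * (D * C1 * ball_size 1 \<beta> m N) powr \<theta>)"
        using D \<theta> by (intro mult_left_mono powr_mono2 wup) (auto intro: sum_nonneg)
      also have "\<dots> = B * ball_size \<theta> (\<beta> * \<theta>) m N"
        using D C1 by (simp add: B_def W powr_mult)
      finally show "(\<Sum>k\<in>sym_interval m N. \<bar>x k\<bar> powr p * shifted_weight \<beta> k) \<le> B * ball_size \<theta> (\<beta> * \<theta>) m N" .
    qed auto
    have bdd: "bdd_above (range (mean (\<lambda>k. \<bar>x k\<bar>) m))" for m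
      by (rule mean_bounded_of_morrey_bound[OF p pq \<beta> mb])
    have y0: "0 \<le> y k" for k
    proof -
      have "0 \<le> mean (\<lambda>k. \<bar>x k\<bar>) k 0" by (rule mean_nonneg) auto
      also have "\<dots> \<le> y k" unfolding y_def using bdd by (intro cSUP_upper) auto
      finally show ?thesis .
    qed
    have "y k \<le> B'" if "\<forall>n. mean (\<lambda>k. \<bar>x k\<bar>) k n \<le> B'" for k B'
      unfolding y_def using that by (intro cSUP_least) auto
    then have my: "morrey_bound p q \<beta> y (C2 * B)" using maximal mb y0 by blast
    have Kp: "(K powr (1/p) * A) powr p = D * (C2 * B) * E powr \<theta>"
      using K A p by (simp add: powr_mult powr_powr) (simp add: K_def B_def)
    have "morrey_norm ?w p q y \<le> ereal (K powr (1/p) * A)"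
    proof (subst morrey_norm_le_iff; (intro allI)?)
      fix m N
      have "(\<Sum>k\<in>sym_interval m N. \<bar>y k\<bar> powr p * ?w k) \<le> (\<Sum>k\<in>sym_interval m N. y k powr p * (D * shifted_weight \<beta> k))"
        unfolding D_def abs_of_nonneg[OF y0] by (intro sum_mono mult_left_mono power_weight_comparable) auto
      also have "\<dots> = D * (\<Sum>k\<in>sym_interval m N. y k powr p * shifted_weight \<beta> k)"
        by (simp add: sum_distrib_left mult_ac)
      also have "\<dots> \<le> D * (C2 * B * ball_size 1 \<beta> m N powr \<theta>)"
        using my D unfolding W[symmetric] by (intro mult_left_mono) (auto simp: morrey_bound_def \<theta>_def)
      also have "\<dots> \<le> D * (C2 * B * (E * (\<Sum>k\<in>sym_interval m N. ?w k)) powr \<theta>)"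
        using D C2 \<theta> by (intro mult_left_mono powr_mono2 wlow) (auto simp: B_def)
      also have "\<dots> = (K powr (1/p) * A) powr p * (\<Sum>k\<in>sym_interval m N. ?w k) powr \<theta>"
        unfolding Kp using E by (simp add: powr_mult sum_nonneg)
      finally show "(\<Sum>k\<in>sym_interval m N. \<bar>y k\<bar> powr p * ?w k)
         \<le> (K powr (1/p) * A) powr p * (\<Sum>k\<in>sym_interval m N. ?w k) powr (1 - p/q)"
        by (simp add: \<theta>_def)
    qed (use p q A in auto)
    then show ?thesis using maximal_op_eq_ereal[OF bdd] by (simp add: y_def)
  qed
  show ?thesis unfolding maximal_op_bounded_on_morrey_def
  proof (intro exI[of _ "K powr (1/p)"] conjI ballI)
    show "0 < K powr (1/p)" using K by simp
    fix x assume "x \<in> morrey_space ?w p q"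
    then have "morrey_norm ?w p q x < \<infinity>" by (simp add: morrey_space_def)
    then obtain A where A: "morrey_norm ?w p q x = ereal A" "A \<ge> 0"
      using morrey_norm_nonneg[of ?w p q x] by (cases "morrey_norm ?w p q x") auto
    let ?y = "\<lambda>m. SUP N. mean (\<lambda>k. \<bar>x k\<bar>) m N"
    have *: "(\<forall>m. maximal_op x m = ereal (?y m)) \<and> morrey_norm ?w p q ?y \<le> ereal (K powr (1/p) * A)"
      using A by (intro main) auto
    show "\<exists>y\<in>morrey_space ?w p q. (\<forall>m. maximal_op x m = ereal (y m)) \<and>
        morrey_norm ?w p q y \<le> ereal (K powr (1/p)) * morrey_norm ?w p q x"
    proof (intro bexI[of _ ?y])
      show "?y \<in> morrey_space ?w p q"
        using * le_less_trans[of _ "ereal (K powr (1/p) * A)" \<infinity>] by (auto simp: morrey_space_def)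
    qed (use * A in auto)
  qed
qed

subsection \<open>Necessity of the conditions on the exponent\<close>

lemma morrey_norm_le_lq_norm:
  assumes p: "1 < p" and pq: "p < q" and w: "\<And>k. 0 < \<omega> k"
    and fin: "finite T" and x: "\<And>k. 0 \<le> x k" and supp: "\<And>k. k \<notin> T \<Longrightarrow> x k = 0"
  shows "morrey_norm \<omega> p q x \<le> ereal ((\<Sum>k\<in>T. x k powr q * \<omega> k) powr (1/q))"
proof (subst morrey_norm_le_iff; (intro allI)?)
  fix m N
  let ?S = "sym_interval m N"
  have w0: "0 \<le> \<omega> k" for k using w[of k] by simp
  have "(\<Sum>k\<in>?S. x k powr q * \<omega> k) = (\<Sum>k\<in>?S \<inter> T. x k powr q * \<omega> k)"
    using supp p pq by (intro sum.mono_neutral_right) auto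
  also have "\<dots> \<le> (\<Sum>k\<in>T. x k powr q * \<omega> k)"
    using fin w0 by (intro sum_mono2) auto
  finally have U: "(\<Sum>k\<in>?S. x k powr q * \<omega> k) \<le> (\<Sum>k\<in>T. x k powr q * \<omega> k)" .
  have "(\<Sum>k\<in>?S. \<bar>x k\<bar> powr p * \<omega> k) \<le> (\<Sum>k\<in>?S. (\<bar>x k\<bar> powr p) powr (q/p) * \<omega> k) powr (1/(q/p)) * (\<Sum>k\<in>?S. \<omega> k) powr (1 - 1/(q/p))"
    using p pq w0 by (intro weighted_Hoelder_sum) auto
  also have "\<dots> = (\<Sum>k\<in>?S. x k powr q * \<omega> k) powr (p/q) * (\<Sum>k\<in>?S. \<omega> k) powr (1 - p/q)"
    using p pq x by (simp add: powr_powr)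
  also have "\<dots> \<le> (\<Sum>k\<in>T. x k powr q * \<omega> k) powr (p/q) * (\<Sum>k\<in>?S. \<omega> k) powr (1 - p/q)"
    using U p pq w0 by (intro mult_right_mono powr_mono2) (auto intro!: sum_nonneg)
  also have "\<dots> = ((\<Sum>k\<in>T. x k powr q * \<omega> k) powr (1/q)) powr p * (\<Sum>k\<in>?S. \<omega> k) powr (1 - p/q)"
    by (simp add: powr_powr)
  finally show "(\<Sum>k\<in>?S. \<bar>x k\<bar> powr p * \<omega> k)
    \<le> ((\<Sum>k\<in>T. x k powr q * \<omega> k) powr (1/q)) powr p * (\<Sum>k\<in>?S. \<omega> k) powr (1 - p/q)" .
qed (use p pq w in auto)

lemma necessary_test:
  assumes p: "1 < p" and pq: "p < q" and w: "\<And>k. 0 < \<omega> k"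
    and bounded: "maximal_op_bounded_on_morrey \<omega> p q"
  shows "\<exists>C>0. \<forall>x K. (\<forall>k. 0 \<le> x k) \<longrightarrow> (\<forall>k. k \<notin> {1..2 * int K} \<longrightarrow> x k = 0) \<longrightarrow>
    (\<Sum>k\<in>sym_interval 0 K. \<omega> k) * ((\<Sum>k\<in>{1..2 * int K}. x k) / (6 * real K + 1)) powr q
      \<le> C * (\<Sum>k\<in>{1..2 * int K}. x k powr q * \<omega> k)"
proof -
  obtain C where C: "C > 0" and bd: "\<And>x. x \<in> morrey_space \<omega> p q \<Longrightarrow>
          \<exists>y\<in>morrey_space \<omega> p q. (\<forall>m. maximal_op x m = ereal (y m)) \<and>
            morrey_norm \<omega> p q y \<le> ereal C * morrey_norm \<omega> p q x"
    using bounded unfolding maximal_op_bounded_on_morrey_def by auto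
  have "(\<Sum>k\<in>sym_interval 0 K. \<omega> k) * ((\<Sum>k\<in>{1..2 * int K}. x k) / (6 * real K + 1)) powr q
      \<le> C powr q * (\<Sum>k\<in>{1..2 * int K}. x k powr q * \<omega> k)"
    if x: "\<forall>k. 0 \<le> x k" and supp: "\<forall>k. k \<notin> {1..2 * int K} \<longrightarrow> x k = 0" for x K
  proof -
    let ?T = "{1..2 * int K}"
    define U where "U = (\<Sum>k\<in>?T. x k powr q * \<omega> k)"
    define V where "V = (\<Sum>k\<in>sym_interval 0 K. \<omega> k)"
    define t where "t = (\<Sum>k\<in>?T. x k) / (6 * real K + 1)"
    have w0: "0 \<le> \<omega> k" for k using w[of k] by simp
    have U: "U \<ge> 0" unfolding U_def by (intro sum_nonneg) (auto simp: w0)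
    have V: "V > 0" unfolding V_def by (intro sum_sym_interval_pos w)
    have t: "t \<ge> 0" unfolding t_def using x by (auto intro!: divide_nonneg_nonneg sum_nonneg)
    have norm_x: "morrey_norm \<omega> p q x \<le> ereal (U powr (1/q))"
      unfolding U_def using p pq w x supp by (intro morrey_norm_le_lq_norm) auto
    then have "x \<in> morrey_space \<omega> p q"
      using le_less_trans[of _ "ereal (U powr (1/q))" \<infinity>] by (auto simp: morrey_space_def)
    from bd[OF this] obtain y where y: "\<And>m. maximal_op x m = ereal (y m)"
      and norm_y: "morrey_norm \<omega> p q y \<le> ereal C * morrey_norm \<omega> p q x" by auto
    have "morrey_norm \<omega> p q y \<le> ereal C * ereal (U powr (1/q))"
      using norm_y norm_x C by (elim order_trans) (intro ereal_mult_left_mono, auto)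
    then have "morrey_norm \<omega> p q y \<le> ereal (C * U powr (1/q))" by simp
    then have "(\<Sum>k\<in>sym_interval 0 K. \<bar>y k\<bar> powr p * \<omega> k) \<le> (C * U powr (1/q)) powr p * V powr (1 - p/q)"
      using C p pq w by (subst (asm) morrey_norm_le_iff) (auto simp: V_def)
    also have "(C * U powr (1/q)) powr p = C powr p * U powr (p/q)"
      using C U by (simp add: powr_mult powr_powr)
    finally have yle: "(\<Sum>k\<in>sym_interval 0 K. \<bar>y k\<bar> powr p * \<omega> k) \<le> C powr p * U powr (p/q) * V powr (1 - p/q)" .
    have ty: "t \<le> y m" if m: "m \<in> sym_interval 0 K" for m
    proof -
      have "(\<Sum>k\<in>?T. x k) \<le> (\<Sum>k\<in>sym_interval m (3 * K). \<bar>x k\<bar>)"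
        using m x by (simp, intro sum_mono2) (auto simp: sym_interval_eq)
      then have "t \<le> mean (\<lambda>k. \<bar>x k\<bar>) m (3 * K)"
        unfolding t_def mean_def by (simp add: divide_right_mono)
      moreover have "ereal (mean (\<lambda>k. \<bar>x k\<bar>) m (3 * K)) \<le> ereal (y m)"
        unfolding y[symmetric] maximal_op_eq_mean by (intro SUP_upper) auto
      ultimately show ?thesis by simp
    qed
    have "t powr p * V = (\<Sum>k\<in>sym_interval 0 K. t powr p * \<omega> k)"
      by (simp add: V_def sum_distrib_left)
    also have "\<dots> \<le> (\<Sum>k\<in>sym_interval 0 K. \<bar>y k\<bar> powr p * \<omega> k)"
      using ty t p w0 by (intro sum_mono mult_right_mono powr_mono2 order_trans[OF ty abs_ge_self]) auto
    also note yle
    finally have "t powr p * V / V powr (1 - p/q) \<le> C powr p * U powr (p/q)"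
      using V by (simp add: divide_le_eq)
    also have "t powr p * V / V powr (1 - p/q) = t powr p * V powr (p/q)"
      using V by (simp add: powr_diff)
    finally have "(t powr p * V powr (p/q)) powr (q/p) \<le> (C powr p * U powr (p/q)) powr (q/p)"
      using p pq by (intro powr_mono2) auto
    then have "t powr q * V \<le> C powr q * U"
      using p pq V U C t by (simp add: powr_mult powr_powr)
    then show ?thesis by (simp add: U_def V_def t_def mult.commute)
  qed
  then show ?thesis using C by (intro exI[of _ "C powr q"]) auto
qed

lemma ex_harm_greater: "\<exists>K\<ge>1. (z::real) < harm K"
proof -
  have "\<forall>\<^sub>F n in sequentially. z < harm n" 
    using harm_at_top unfolding filterlim_at_top_dense by blast
  then have "\<forall>\<^sub>F n in sequentially. z < harm n \<and> n \<ge> 1" 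
    using eventually_ge_at_top by (rule eventually_conj)
  then show ?thesis by (auto dest: eventually_happens)
qed

lemma harm_eq_sum_int: "harm K = (\<Sum>k\<in>{1..int K}. 1 / real_of_int k)"
  unfolding harm_def
  by (intro sum.reindex_bij_witness[of _ nat int]) (auto simp: inverse_eq_divide)

lemma power_weight_of_pos: "k > 0 \<Longrightarrow> power_weight \<beta> k = real_of_int k powr \<beta>"
  by (simp add: power_weight_def)

lemma not_bounded_of_le_minus_one:
  assumes p: "1 < p" and pq: "p < q" and \<beta>: "\<beta> \<le> -1"
  shows "\<not> maximal_op_bounded_on_morrey (power_weight \<beta>) p q"
proof
  let ?w = "power_weight \<beta>"
  assume "maximal_op_bounded_on_morrey ?w p q"
  from necessary_test[OF p pq power_weight_pos this] obtain C where C: "C > 0" and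
    test: "\<forall>x K. (\<forall>k. 0 \<le> x k) \<longrightarrow> (\<forall>k. k \<notin> {1..2 * int K} \<longrightarrow> x k = 0) \<longrightarrow>
    (\<Sum>k\<in>sym_interval 0 K. ?w k) * ((\<Sum>k\<in>{1..2 * int K}. x k) / (6 * real K + 1)) powr q
      \<le> C * (\<Sum>k\<in>{1..2 * int K}. x k powr q * ?w k)" by auto
  obtain K where K: "K \<ge> 1" and harm: "2 * C * 6 powr q < harm K" using ex_harm_greater by blast
  define x where "x = (\<lambda>k. if k \<in> {int K..2 * int K} then 1 else 0 :: real)"
  have T: "{1..2 * int K} \<inter> {int K..2 * int K} = {int K..2 * int K}" using K by auto
  have if_sum: "(\<Sum>k\<in>{1..2 * int K}. if k \<in> {int K..2 * int K} then h k else 0) = (\<Sum>k\<in>{int K..2 * int K}. h k)"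
    for h :: "int \<Rightarrow> real"
    by (simp only: sum.inter_restrict[OF finite_atLeastAtMost_int, symmetric] T)
  have sum_x: "(\<Sum>k\<in>{1..2 * int K}. x k) = real K + 1"
    unfolding x_def if_sum by simp
  have "1/6 \<le> (real K + 1) / (6 * real K + 1)" by (simp add: field_simps)
  then have avg: "(1/6) powr q \<le> ((real K + 1) / (6 * real K + 1)) powr q"
    using p pq by (intro powr_mono2) auto
  have "(\<Sum>k\<in>{1..2 * int K}. x k powr q * ?w k) = (\<Sum>k\<in>{1..2 * int K}. if k \<in> {int K..2 * int K} then ?w k else 0)"
    by (intro sum.cong) (auto simp: x_def)
  also have "\<dots> = (\<Sum>k\<in>{int K..2 * int K}. ?w k)" by (rule if_sum)
  also have "\<dots> \<le> (\<Sum>k\<in>{int K..2 * int K}. real K powr \<beta>)"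
    using K \<beta> by (intro sum_mono) (auto simp: power_weight_of_pos intro!: powr_mono2')
  also have "\<dots> = (real K + 1) * real K powr \<beta>" by simp
  also have "\<dots> \<le> (2 * real K) * real K powr \<beta>" using K by (intro mult_right_mono) auto
  also have "\<dots> = 2 * real K powr (\<beta> + 1)" using K by (simp add: powr_add)
  finally have U: "(\<Sum>k\<in>{1..2 * int K}. x k powr q * ?w k) \<le> 2 * real K powr (\<beta> + 1)" .
  have "real K powr (\<beta> + 1) * harm K = (\<Sum>k\<in>{1..int K}. real K powr (\<beta> + 1) * (1 / real_of_int k))"
    by (simp only: harm_eq_sum_int sum_distrib_left)
  also have "\<dots> \<le> (\<Sum>k\<in>{1..int K}. ?w k)"
  proof (intro sum_mono)
    fix k assume k: "k \<in> {1..int K}"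
    then have "real_of_int k \<le> real K" by simp
    then have "real K powr (\<beta> + 1) * (1 / real_of_int k) \<le> real_of_int k powr (\<beta> + 1) * (1 / real_of_int k)"
      using k \<beta> by (intro mult_right_mono powr_mono2') auto
    also have "\<dots> = ?w k" using k by (simp add: power_weight_of_pos powr_add)
    finally show "real K powr (\<beta> + 1) * (1 / real_of_int k) \<le> ?w k" .
  qed
  also have "\<dots> \<le> (\<Sum>k\<in>sym_interval 0 K. ?w k)"
    by (intro sum_mono2) (auto simp: sym_interval_eq)
  finally have V: "real K powr (\<beta> + 1) * harm K \<le> (\<Sum>k\<in>sym_interval 0 K. ?w k)" .
  have "real K powr (\<beta> + 1) * harm K * (1/6) powr q
     \<le> (\<Sum>k\<in>sym_interval 0 K. ?w k) * ((\<Sum>k\<in>{1..2 * int K}. x k) / (6 * real K + 1)) powr q"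
    unfolding sum_x by (intro mult_mono V avg) (auto intro: sum_nonneg)
  also have "\<dots> \<le> C * (\<Sum>k\<in>{1..2 * int K}. x k powr q * ?w k)"
    using K by (intro test[rule_format]) (auto simp: x_def)
  also have "\<dots> \<le> C * (2 * real K powr (\<beta> + 1))" using U C by (intro mult_left_mono) auto
  finally have "real K powr (\<beta> + 1) * (harm K * (1/6) powr q) \<le> real K powr (\<beta> + 1) * (2 * C)"
    by (simp add: mult_ac)
  then have "harm K * (1/6) powr q \<le> 2 * C" using K by (subst (asm) mult_le_cancel_left_pos) auto
  then have "harm K \<le> 2 * C * 6 powr q" by (simp add: powr_divide field_simps)
  then show False using harm by simp
qed

lemma not_bounded_of_ge:
  assumes p: "1 < p" and pq: "p < q" and \<beta>: "q - 1 \<le> \<beta>"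
  shows "\<not> maximal_op_bounded_on_morrey (power_weight \<beta>) p q"
proof
  let ?w = "power_weight \<beta>"
  have q: "q > 1" using p pq by simp
  assume "maximal_op_bounded_on_morrey ?w p q"
  from necessary_test[OF p pq power_weight_pos this] obtain C where C: "C > 0" and
    test: "\<forall>x K. (\<forall>k. 0 \<le> x k) \<longrightarrow> (\<forall>k. k \<notin> {1..2 * int K} \<longrightarrow> x k = 0) \<longrightarrow>
    (\<Sum>k\<in>sym_interval 0 K. ?w k) * ((\<Sum>k\<in>{1..2 * int K}. x k) / (6 * real K + 1)) powr q
      \<le> C * (\<Sum>k\<in>{1..2 * int K}. x k powr q * ?w k)" by auto
  define E where "E = 2 * 3 powr \<bar>\<beta>\<bar> * 2 powr \<bar>\<beta>\<bar>"
  have E: "E > 0" by (simp add: E_def)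
  define Z where "Z = (E * 7 powr q * C) powr (1 / (q - 1))"
  obtain K where K: "K \<ge> 1" and harm: "Z < harm K" using ex_harm_greater by blast
  have h0: "harm K > (0::real)" using K by simp
  define x where "x = (\<lambda>k. if k \<in> {1..int K} then 1 / real_of_int k else 0 :: real)"
  have T: "{1..2 * int K} \<inter> {1..int K} = {1..int K}" by auto
  have if_sum: "(\<Sum>k\<in>{1..2 * int K}. if k \<in> {1..int K} then h k else 0) = (\<Sum>k\<in>{1..int K}. h k)"
    for h :: "int \<Rightarrow> real"
    by (simp only: sum.inter_restrict[OF finite_atLeastAtMost_int, symmetric] T)
  have sum_x: "(\<Sum>k\<in>{1..2 * int K}. x k) = harm K"
    unfolding x_def if_sum harm_eq_sum_int ..
  have "harm K / (7 * real K) \<le> harm K / (6 * real K + 1)"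
    using K by (intro divide_left_mono) (auto simp: harm_nonneg)
  then have avg: "(harm K / (7 * real K)) powr q \<le> (harm K / (6 * real K + 1)) powr q"
    using q by (intro powr_mono2) (auto simp: harm_nonneg)
  have "(\<Sum>k\<in>{1..2 * int K}. x k powr q * ?w k) = (\<Sum>k\<in>{1..2 * int K}. if k \<in> {1..int K} then (1 / real_of_int k) powr q * ?w k else 0)"
    by (intro sum.cong) (auto simp: x_def)
  also have "\<dots> = (\<Sum>k\<in>{1..int K}. (1 / real_of_int k) powr q * ?w k)" by (rule if_sum)
  also have "\<dots> \<le> (\<Sum>k\<in>{1..int K}. real K powr (\<beta> + 1 - q) * (1 / real_of_int k))"
  proof (intro sum_mono)
    fix k assume k: "k \<in> {1..int K}"
    have "(1 / real_of_int k) powr q * ?w k = real_of_int k powr (\<beta> + 1 - q) * (1 / real_of_int k)"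
      using k by (simp add: power_weight_of_pos powr_divide powr_add powr_diff)
    also have "\<dots> \<le> real K powr (\<beta> + 1 - q) * (1 / real_of_int k)"
      using k \<beta> by (intro mult_right_mono powr_mono2) auto
    finally show "(1 / real_of_int k) powr q * ?w k \<le> real K powr (\<beta> + 1 - q) * (1 / real_of_int k)" .
  qed
  also have "\<dots> = real K powr (\<beta> + 1 - q) * harm K"
    by (simp only: harm_eq_sum_int sum_distrib_left)
  finally have U: "(\<Sum>k\<in>{1..2 * int K}. x k powr q * ?w k) \<le> real K powr (\<beta> + 1 - q) * harm K" .
  have "real K powr (\<beta> + 1) \<le> (real K + 1) powr (\<beta> + 1)" using \<beta> q by (intro powr_mono2) auto
  also have "\<dots> = ball_size 1 \<beta> 0 K" by (simp add: ball_size_def powr_add)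
  also have "\<dots> \<le> 2 * 3 powr \<bar>\<beta>\<bar> * (\<Sum>k\<in>sym_interval 0 K. shifted_weight \<beta> k)"
    by (rule sum_shifted_weight_ge)
  also have "\<dots> \<le> 2 * 3 powr \<bar>\<beta>\<bar> * (\<Sum>k\<in>sym_interval 0 K. 2 powr \<bar>\<beta>\<bar> * ?w k)"
    by (intro mult_left_mono sum_mono power_weight_comparable) auto
  also have "\<dots> = E * (\<Sum>k\<in>sym_interval 0 K. ?w k)"
    unfolding sum_distrib_left[symmetric] by (simp add: E_def)
  finally have V: "real K powr (\<beta> + 1) \<le> E * (\<Sum>k\<in>sym_interval 0 K. ?w k)" .
  have "real K powr (\<beta> + 1 - q) * (harm K powr q / 7 powr q) = real K powr (\<beta> + 1) * (harm K / (7 * real K)) powr q"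
    using K by (simp add: powr_diff powr_divide powr_mult)
  also have "\<dots> \<le> E * (\<Sum>k\<in>sym_interval 0 K. ?w k) * ((\<Sum>k\<in>{1..2 * int K}. x k) / (6 * real K + 1)) powr q"
    unfolding sum_x using E by (intro mult_mono V avg) (auto intro!: mult_nonneg_nonneg sum_nonneg)
  also have "\<dots> = E * ((\<Sum>k\<in>sym_interval 0 K. ?w k) * ((\<Sum>k\<in>{1..2 * int K}. x k) / (6 * real K + 1)) powr q)"
    by simp
  also have "\<dots> \<le> E * (C * (\<Sum>k\<in>{1..2 * int K}. x k powr q * ?w k))"
    using E by (intro mult_left_mono test[rule_format]) (auto simp: x_def)
  also have "\<dots> \<le> E * (C * (real K powr (\<beta> + 1 - q) * harm K))" 
    using U C E by (intro mult_left_mono) auto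
  finally have "real K powr (\<beta> + 1 - q) * (harm K powr q / 7 powr q) \<le> real K powr (\<beta> + 1 - q) * (E * C * harm K)"
    by (simp add: mult_ac)
  then have "harm K powr q / 7 powr q \<le> E * C * harm K" using K by (subst (asm) mult_le_cancel_left_pos) auto
  then have "harm K powr q \<le> E * 7 powr q * C * harm K" by (simp add: divide_le_eq mult_ac)
  also have "harm K powr q = harm K powr (q - 1) * (harm K :: real)" using h0 by (simp add: powr_diff)
  finally have "harm K powr (q - 1) \<le> E * 7 powr q * C" using h0 by simp
  moreover have "Z powr (q - 1) < harm K powr (q - 1)"
    using harm q by (intro powr_less_mono2) (auto simp: Z_def)
  moreover have "Z powr (q - 1) = E * 7 powr q * C" using q E C by (simp add: Z_def powr_powr)
  ultimately show False by simp
qed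

theorem theorem4p11:
  fixes p q \<beta> :: real
  assumes "1 < p" and "p < q"
  shows "maximal_op_bounded_on_morrey (power_weight \<beta>) p q \<longleftrightarrow> -1 < \<beta> \<and> \<beta> < q - 1"
  using maximal_op_bounded_if[OF assms] not_bounded_of_le_minus_one[OF assms] not_bounded_of_ge[OF assms]
  by (meson not_le)

end
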